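(* Let $0<\gamma\le1$, $\alpha\in\mathbb{R}$, let $A\in C(\Delta_T^2;B_\alpha)$, and assume that $\hat\delta A\in Z\hat C^{\gamma}(\Delta_T^3;B_\alpha)$ belongs to the admissible selection domain $\mathcal D^{\mathsf s}_\gamma(\Delta_T^3;B_\alpha)$ of the chosen splitting rule $\mathsf s$. Define a path $I^{\mathsf s}_{\gamma,\alpha}(A)_t:=\mathcal J^{\mathsf s}_{\gamma,\alpha}(A)_{t0}$, where $\mathcal J^{\mathsf s}_{\gamma,\alpha}(A):=A-\hat\Lambda^{\mathsf s}_{S,\gamma,\alpha}(\hat\delta A)$. Then $$\hat\delta I^{\mathsf s}_{\gamma,\alpha}(A)=\mathcal J^{\mathsf s}_{\gamma,\alpha}(A).$$ Equivalently, $$(\hat\delta I^{\mathsf s}_{\gamma,\alpha}(A))_{ts}=A_{ts}-\bigl(\hat\Lambda^{\mathsf s}_{S,\gamma,\alpha}(\hat\delta A)\bigr)_{ts}.$$ The path $I^{\mathsf s}_{\gamma,\alpha}(A)$ is the unique path $I$ satisfying $\hat\delta I=\mathcal J^{\mathsf s}_{\gamma,\alpha}(A)$ and $I_0=0$.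
   Context: Fix $T>0$. $(B_\alpha)_{\alpha\in\mathbb{R}}$ is a Banach scale, i.e. a family of Banach spaces such that for $\alpha\le\beta$ the embedding $B_\beta\hookrightarrow B_\alpha$ is continuous. $S=(S_t)_{t\ge0}$ is an analytic (in particular strongly continuous) semigroup of bounded linear operators acting on this scale, with $S_0=\mathrm{Id}$; for every $\alpha\in\mathbb{R}$, $\varepsilon\in(0,1)$ there is $C_{\alpha,\varepsilon,T}>0$ with $\|S_tx\|_{B_{\alpha+\varepsilon}}\le C_{\alpha,\varepsilon,T}t^{-\varepsilon}\|x\|_{B_\alpha}$ and $\|(S_t-\mathrm{Id})x\|_{B_\alpha}\le C_{\alpha,\varepsilon,T}t^{\varepsilon}\|x\|_{B_{\alpha+\varepsilon}}$ for all $t\in(0,T]$. $\Delta_T^n:=\{(t_1,\dots,t_n)\in[0,T]^n:0\le t_n\le\dots\le t_1\le T\}$; $C(\Delta_T^n;B_\alpha)$ denotes continuous maps; $(\hat\delta g)_{t_1\dots t_{n+1}}:=\sum_{i=1}^{n+1}(-1)^ig_{t_1\dots\hat t_i\dots t_{n+1}}-(S_{t_1-t_2}-\mathrm{Id})g_{t_2\dots t_{n+1}}$; so $(\hat\delta I)_{ts}=I_t-S_{t-s}I_s$ for paths and $(\hat\delta g)_{tus}=g_{ts}-g_{tu}-S_{t-u}g_{us}$ for two-increments. For $g\in C(\Delta_T^2;B_\alpha)$: $\|g\|_{\gamma,\alpha}:=\sup_{s<t}\|g_{ts}\|_{B_\alpha}/|t-s|^\gamma$, $\|g\|_{1,\log;\alpha}:=\sup_{s<t}\frac{\|g_{ts}\|_{B_\alpha}}{|t-s|(1+|\log|t-s||)}$;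 $C^\gamma(\Delta_T^2;B_\alpha)$, $C^1_{\log}(\Delta_T^2;B_\alpha)$ are the sets of finite norm. For $h\in C(\Delta_T^3;B_\alpha)$: $\|h\|_{\gamma,\alpha}:=\inf\{\sum_{j=1}^m\sup_{s<u<t}\frac{\|h_{j,tus}\|_{B_\alpha}}{|t-u|^{\rho_j}|u-s|^{\gamma-\rho_j}}:h=\sum_{j=1}^mh_j,\ m\in\mathbb{N},\ 0<\rho_j<\gamma\}$; $Z\hat C^\gamma(\Delta_T^3;B_\alpha)$ is the set of $h$ with $\hat\delta h=0$ and finite norm. Dyadic recursion. Let $\mathcal D:=\bigcup_{n\ge0}\{kT2^{-n}:0\le k\le2^n\}$; a dyadic interval is an interval between consecutive points of some $\{kT2^{-n}:0\le k\le 2^n\}$. For $H\in Z\hat C^\gamma(\Delta_T^3;B_\alpha)$ let $B^H_{ts}:=-H_{ts0}$. A splitting rule $\mathsf s$ assigns to each dyadic interval $[a,c]$ with midpoint $b$ carrying a residual $Q_{ca}\in B_\alpha$ generated by the recursion two child residuals $Q^{\mathsf s}_{cb},Q^{\mathsf s}_{ba}\in B_\alpha$ with $(\ast)$ $Q_{ca}=Q^{\mathsf s}_{cb}+S_{c-b}Q^{\mathsf s}_{ba}+H_{cba}$. The recursion builds $I^{\mathsf s}(H):\mathcal D\to B_\alpha$ and $R^{\mathsf s}_{ts}(H):=B^H_{ts}-I^{\mathsf s}_t(H)+S_{t-s}I^{\mathsf s}_s(H)$: $I^{\mathsf s}_0:=0$, $I^{\mathsf s}_T:=B^H_{T0}$;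 given endpoint values on $[a,c]$, put $Q_{ca}:=R^{\mathsf s}_{ca}$, apply $\mathsf s$, and set $I^{\mathsf s}_b:=B^H_{ba}+S_{b-a}I^{\mathsf s}_a-Q^{\mathsf s}_{ba}$. Admissible selection domain for a fixed linear rule $\mathsf s$ (one for which the generated residuals depend linearly on $H$): a linear subspace $\mathcal D^{\mathsf s}_\gamma(\Delta_T^3;B_\alpha)\subset Z\hat C^\gamma(\Delta_T^3;B_\alpha)$ such that for every $H$ in it the recursion is well defined, $(\ast)$ holds at each step, and, with $L=c-a$ and $C_H\le C_{\mathsf s}\|H\|_{\gamma,\alpha}$, for all generated residuals: if $0<\gamma<1$, $\max\{\|Q^{\mathsf s}_{cb}\|_{B_\alpha},\|Q^{\mathsf s}_{ba}\|_{B_\alpha}\}\le\theta\|Q_{ca}\|_{B_\alpha}+C_HL^\gamma$ with fixed $\theta<2^{-\gamma}$; if $\gamma=1$, $\max\{\|Q^{\mathsf s}_{cb}\|_{B_\alpha},\|Q^{\mathsf s}_{ba}\|_{B_\alpha}\}\le(\tfrac12+C_\ast L^\eta)\|Q_{ca}\|_{B_\alpha}+C_HL$ with fixed $C_\ast,\eta>0$; and moreover $\lim_{h\downarrow0}\sup\{\|(S_h-\mathrm{Id})R^{\mathsf s}_{ts}\|_{B_\alpha}:s\le t,\ s,t\in\mathcal D,\ t+h\le T\}=0$. The Sewing map $\hat\Lambda^{\mathsf s}_{S,\gamma,\alpha}:\mathcal D^{\mathsf s}_\gamma(\Delta_T^3;B_\alpha)\to C^\gamma(\Delta_T^2;B_\alpha)$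 (into $C^1_{\log}(\Delta_T^2;B_\alpha)$ if $\gamma=1$) sends $H$ to the unique continuous extension to $\Delta_T^2$ of $R^{\mathsf s}(H)$; it is a continuous linear map with $\hat\delta\hat\Lambda^{\mathsf s}_{S,\gamma,\alpha}H=H$. *)

theory Defs
  imports "HOL-Analysis.Analysis"
begin

section \<open>Banach spaces carried by subsets of a common vector space\<close>

text \<open>
  A Banach scale is a real-indexed family, so its members cannot be separate types. All
  \<open>B\<^sub>\<alpha>\<close> are linear subspaces of one ambient real vector space, each with its own norm, and the
  embeddings are inclusions.  The spaces are real; a complex Banach space is covered through its
  underlying real space.
\<close>

text \<open>The value outside \<open>V\<close> is irrelevant; it only serves the totality requirements of
  \<^locale>\<open>Metric_space\<close>.\<close>

definition ndist :: "'a::real_vector set \<Rightarrow> ('a \<Rightarrow> real) \<Rightarrow> 'a \<Rightarrow> 'a \<Rightarrow> real" where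
  "ndist V N x y = (if x \<in> V \<and> y \<in> V then N (x - y) else 0)"

definition ntopology :: "'a::real_vector set \<Rightarrow> ('a \<Rightarrow> real) \<Rightarrow> 'a topology" where
  "ntopology V N = Metric_space.mtopology V (ndist V N)"

definition banach_on :: "'a::real_vector set \<Rightarrow> ('a \<Rightarrow> real) \<Rightarrow> bool" where
  "banach_on V N \<longleftrightarrow>
     subspace V \<and>
     (\<forall>x\<in>V. 0 \<le> N x \<and> (N x = 0 \<longleftrightarrow> x = 0)) \<and>
     (\<forall>c. \<forall>x\<in>V. N (c *\<^sub>R x) = \<bar>c\<bar> * N x) \<and>
     (\<forall>x\<in>V. \<forall>y\<in>V. N (x + y) \<le> N x + N y) \<and>
     Metric_space.mcomplete V (ndist V N)"

definition banach_scale :: "(real \<Rightarrow> 'a::real_vector set) \<Rightarrow> (real \<Rightarrow> 'a \<Rightarrow> real) \<Rightarrow> bool" where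
  "banach_scale B nrm \<longleftrightarrow>
     (\<forall>\<alpha>. banach_on (B \<alpha>) (nrm \<alpha>)) \<and>
     (\<forall>\<alpha> \<beta>. \<alpha> \<le> \<beta> \<longrightarrow>
        continuous_map (ntopology (B \<beta>) (nrm \<beta>)) (ntopology (B \<alpha>) (nrm \<alpha>)) (\<lambda>x. x))"


section \<open>Analytic semigroups\<close>

definition bounded_operator_on ::
  "'a::real_vector set \<Rightarrow> ('a \<Rightarrow> real) \<Rightarrow> ('a \<Rightarrow> 'a) \<Rightarrow> bool" where
  "bounded_operator_on V N f \<longleftrightarrow>
     f ` V \<subseteq> V \<and>
     (\<forall>x\<in>V. \<forall>y\<in>V. f (x + y) = f x + f y) \<and>
     (\<forall>c. \<forall>x\<in>V. f (c *\<^sub>R x) = c *\<^sub>R f x) \<and>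
     (\<exists>K. \<forall>x\<in>V. N (f x) \<le> K * N x)"

definition c0_semigroup_on ::
  "'a::real_vector set \<Rightarrow> ('a \<Rightarrow> real) \<Rightarrow> (real \<Rightarrow> 'a \<Rightarrow> 'a) \<Rightarrow> bool" where
  "c0_semigroup_on V N S \<longleftrightarrow>
     (\<forall>t\<ge>0. bounded_operator_on V N (S t)) \<and>
     (\<forall>x\<in>V. S 0 x = x) \<and>
     (\<forall>t\<ge>0. \<forall>s\<ge>0. \<forall>x\<in>V. S (t + s) x = S t (S s x)) \<and>
     (\<forall>x\<in>V. continuous_map (top_of_set {0..}) (ntopology V N) (\<lambda>t. S t x))"

text \<open>
  Analyticity means a holomorphic extension to a sector, as operators on the complexification
  \<open>V \<times> V\<close>, where \<open>(x, y)\<close> stands for \<open>x + \<i>y\<close>. The sum norm below is equivalent to any of the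
  usual complexification norms, and only its topology matters.
\<close>

definition cscale :: "complex \<Rightarrow> 'a::real_vector \<times> 'a \<Rightarrow> 'a \<times> 'a" where
  "cscale z p = (Re z *\<^sub>R fst p - Im z *\<^sub>R snd p, Re z *\<^sub>R snd p + Im z *\<^sub>R fst p)"

definition cnrm :: "('a \<Rightarrow> real) \<Rightarrow> 'a \<times> 'a \<Rightarrow> real" where
  "cnrm N p = N (fst p) + N (snd p)"

definition bounded_complex_operator_on ::
  "'a::real_vector set \<Rightarrow> ('a \<Rightarrow> real) \<Rightarrow> ('a \<times> 'a \<Rightarrow> 'a \<times> 'a) \<Rightarrow> bool" where
  "bounded_complex_operator_on V N F \<longleftrightarrow>
     bounded_operator_on (V \<times> V) (cnrm N) F \<and>
     (\<forall>z. \<forall>p\<in>V \<times> V. F (cscale z p) = cscale z (F p))"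

definition sector :: "real \<Rightarrow> complex set" where
  "sector \<phi> = {z. z \<noteq> 0 \<and> \<bar>Arg z\<bar> < \<phi>}"

text \<open>The fourth conjunct is complex differentiability of \<open>z \<mapsto> Z z\<close> in operator norm, with
  derivative \<open>D\<close> at \<open>z\<close>.\<close>

definition analytic_semigroup_on ::
  "'a::real_vector set \<Rightarrow> ('a \<Rightarrow> real) \<Rightarrow> (real \<Rightarrow> 'a \<Rightarrow> 'a) \<Rightarrow> bool" where
  "analytic_semigroup_on V N S \<longleftrightarrow>
     c0_semigroup_on V N S \<and>
     (\<exists>\<phi> Z. 0 < \<phi> \<and> \<phi> \<le> pi / 2 \<and>
        (\<forall>z\<in>sector \<phi>. bounded_complex_operator_on V N (Z z)) \<and>
        (\<forall>t>0. \<forall>x\<in>V. \<forall>y\<in>V. Z (complex_of_real t) (x, y) = (S t x, S t y)) \<and>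
        (\<forall>z\<in>sector \<phi>. \<forall>w\<in>sector \<phi>. \<forall>p\<in>V \<times> V. Z (z + w) p = Z z (Z w p)) \<and>
        (\<forall>z\<in>sector \<phi>. \<exists>D. bounded_complex_operator_on V N D \<and>
           (\<forall>e>0. \<exists>d>0. \<forall>w\<in>sector \<phi>. cmod (w - z) < d \<longrightarrow>
              (\<forall>p\<in>V \<times> V. cnrm N (Z w p - Z z p - cscale (w - z) (D p))
                           \<le> e * cmod (w - z) * cnrm N p))) \<and>
        (\<forall>\<psi>. 0 < \<psi> \<and> \<psi> < \<phi> \<longrightarrow>
           (\<forall>p\<in>V \<times> V. ((\<lambda>z. cnrm N (Z z p - p)) \<longlongrightarrow> 0) (at 0 within sector \<psi>))))"

definition analytic_semigroup_on_scale ::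
  "real \<Rightarrow> (real \<Rightarrow> 'a::real_vector set) \<Rightarrow> (real \<Rightarrow> 'a \<Rightarrow> real) \<Rightarrow> (real \<Rightarrow> 'a \<Rightarrow> 'a) \<Rightarrow> bool" where
  "analytic_semigroup_on_scale T B nrm S \<longleftrightarrow>
     (\<forall>\<alpha>. analytic_semigroup_on (B \<alpha>) (nrm \<alpha>) S) \<and>
     (\<forall>\<alpha> \<epsilon>. 0 < \<epsilon> \<and> \<epsilon> < 1 \<longrightarrow>
        (\<exists>C>0. \<forall>t\<in>{0<..T}.
           (\<forall>x\<in>B \<alpha>. S t x \<in> B (\<alpha> + \<epsilon>) \<and>
                     nrm (\<alpha> + \<epsilon>) (S t x) \<le> C * t powr (- \<epsilon>) * nrm \<alpha> x) \<and>
           (\<forall>x\<in>B (\<alpha> + \<epsilon>). nrm \<alpha> (S t x - x) \<le> C * t powr \<epsilon> * nrm (\<alpha> + \<epsilon>) x)))"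


section \<open>Increments\<close>

text \<open>
  Time arguments are decreasing, as in \<open>g\<^sub>t\<^sub>s\<close> with \<open>s \<le> t\<close>. A map defined on a simplex is
  represented by the total function that vanishes outside that simplex, so that equality of
  functions is equality of maps and sets of maps can be linear subspaces.
\<close>

definition simplex2 :: "real \<Rightarrow> (real \<times> real) set" where
  "simplex2 T = {(t, s). 0 \<le> s \<and> s \<le> t \<and> t \<le> T}"

definition simplex3 :: "real \<Rightarrow> (real \<times> real \<times> real) set" where
  "simplex3 T = {(t, u, s). 0 \<le> s \<and> s \<le> u \<and> u \<le> t \<and> t \<le> T}"

definition simplex4 :: "real \<Rightarrow> (real \<times> real \<times> real \<times> real) set" where
  "simplex4 T = {(t, v, u, s). 0 \<le> s \<and> s \<le> u \<and> u \<le> v \<and> v \<le> t \<and> t \<le> T}"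

definition cpaths :: "real \<Rightarrow> 'a::real_vector set \<Rightarrow> ('a \<Rightarrow> real) \<Rightarrow> (real \<Rightarrow> 'a) set" where
  "cpaths T V N = {I.
     continuous_map (top_of_set {0..T}) (ntopology V N) I \<and>
     (\<forall>t. t \<notin> {0..T} \<longrightarrow> I t = 0)}"

definition cincr2 :: "real \<Rightarrow> 'a::real_vector set \<Rightarrow> ('a \<Rightarrow> real) \<Rightarrow> (real \<Rightarrow> real \<Rightarrow> 'a) set" where
  "cincr2 T V N = {g.
     continuous_map (top_of_set (simplex2 T)) (ntopology V N) (\<lambda>(t, s). g t s) \<and>
     (\<forall>t s. (t, s) \<notin> simplex2 T \<longrightarrow> g t s = 0)}"

definition cincr3 ::
  "real \<Rightarrow> 'a::real_vector set \<Rightarrow> ('a \<Rightarrow> real) \<Rightarrow> (real \<Rightarrow> real \<Rightarrow> real \<Rightarrow> 'a) set" where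
  "cincr3 T V N = {h.
     continuous_map (top_of_set (simplex3 T)) (ntopology V N) (\<lambda>(t, u, s). h t u s) \<and>
     (\<forall>t u s. (t, u, s) \<notin> simplex3 T \<longrightarrow> h t u s = 0)}"

text \<open>
  The reduced coboundary for an arbitrary number of time variables \<open>ts = [t\<^sub>1, \<dots>, t\<^sub>n\<^sub>+\<^sub>1]\<close>;
  the list index \<open>i\<close> corresponds to the summation index \<open>i + 1\<close>.
\<close>

definition delta_hat ::
  "(real \<Rightarrow> 'a \<Rightarrow> 'a) \<Rightarrow> (real list \<Rightarrow> 'a::real_vector) \<Rightarrow> real list \<Rightarrow> 'a" where
  "delta_hat S g ts =
     (\<Sum>i<length ts. (-1) ^ (i + 1) *\<^sub>R g (take i ts @ drop (i + 1) ts))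
     - (S (ts ! 0 - ts ! 1) (g (tl ts)) - g (tl ts))"

definition delta1 ::
  "real \<Rightarrow> (real \<Rightarrow> 'a \<Rightarrow> 'a) \<Rightarrow> (real \<Rightarrow> 'a::real_vector) \<Rightarrow> real \<Rightarrow> real \<Rightarrow> 'a" where
  "delta1 T S I t s =
     (if (t, s) \<in> simplex2 T then delta_hat S (\<lambda>ts. I (ts ! 0)) [t, s] else 0)"

definition delta2 ::
  "real \<Rightarrow> (real \<Rightarrow> 'a \<Rightarrow> 'a) \<Rightarrow> (real \<Rightarrow> real \<Rightarrow> 'a::real_vector) \<Rightarrow> real \<Rightarrow> real \<Rightarrow> real \<Rightarrow> 'a" where
  "delta2 T S g t u s =
     (if (t, u, s) \<in> simplex3 T then delta_hat S (\<lambda>ts. g (ts ! 0) (ts ! 1)) [t, u, s] else 0)"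

definition delta3 ::
  "real \<Rightarrow> (real \<Rightarrow> 'a \<Rightarrow> 'a) \<Rightarrow> (real \<Rightarrow> real \<Rightarrow> real \<Rightarrow> 'a::real_vector)
    \<Rightarrow> real \<Rightarrow> real \<Rightarrow> real \<Rightarrow> real \<Rightarrow> 'a" where
  "delta3 T S h t v u s =
     (if (t, v, u, s) \<in> simplex4 T
      then delta_hat S (\<lambda>ts. h (ts ! 0) (ts ! 1) (ts ! 2)) [t, v, u, s] else 0)"

lemma delta1_eq:
  "delta1 T S I t s = (if (t, s) \<in> simplex2 T then I t - S (t - s) (I s) else 0)"
  by (simp add: delta1_def delta_hat_def lessThan_Suc)

lemma delta2_eq:
  "delta2 T S g t u s =
     (if (t, u, s) \<in> simplex3 T then g t s - g t u - S (t - u) (g u s) else 0)"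
  by (simp add: delta2_def delta_hat_def lessThan_Suc)

lemma delta3_eq:
  "delta3 T S h t v u s =
     (if (t, v, u, s) \<in> simplex4 T
      then h t u s - h t v s + h t v u - S (t - v) (h v u s) else 0)"
  by (simp add: delta3_def delta_hat_def lessThan_Suc numeral_eq_Suc)

text \<open>The pieces \<open>hs j\<close> of a decomposition are continuous increments, like \<open>h\<close> itself.\<close>

definition norm3 ::
  "real \<Rightarrow> 'a::real_vector set \<Rightarrow> ('a \<Rightarrow> real) \<Rightarrow> real \<Rightarrow> (real \<Rightarrow> real \<Rightarrow> real \<Rightarrow> 'a) \<Rightarrow> ennreal" where
  "norm3 T V N \<gamma> h = Inf {
     (\<Sum>j<m. SUP (t, u, s) \<in> {(t, u, s). (t, u, s) \<in> simplex3 T \<and> s < u \<and> u < t}.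
        ennreal (N (hs j t u s) / (\<bar>t - u\<bar> powr \<rho> j * \<bar>u - s\<bar> powr (\<gamma> - \<rho> j))))
     | (m::nat) hs \<rho>.
       (\<forall>j<m. hs j \<in> cincr3 T V N \<and> 0 < \<rho> j \<and> \<rho> j < \<gamma>) \<and>
       h = (\<lambda>t u s. \<Sum>j<m. hs j t u s)}"

definition cocycles ::
  "real \<Rightarrow> 'a::real_vector set \<Rightarrow> ('a \<Rightarrow> real) \<Rightarrow> (real \<Rightarrow> 'a \<Rightarrow> 'a) \<Rightarrow> real
    \<Rightarrow> (real \<Rightarrow> real \<Rightarrow> real \<Rightarrow> 'a) set" where
  "cocycles T V N S \<gamma> = {h \<in> cincr3 T V N.
     delta3 T S h = (\<lambda>t v u s. 0) \<and> norm3 T V N \<gamma> h < \<infinity>}"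


section \<open>The dyadic recursion\<close>

definition dyadic_pt :: "real \<Rightarrow> nat \<Rightarrow> nat \<Rightarrow> real" where
  "dyadic_pt T n k = real k * T / 2 ^ n"

definition dyadics :: "real \<Rightarrow> real set" where
  "dyadics T = {dyadic_pt T n k | n k. k \<le> 2 ^ n}"

definition dyadic_interval :: "real \<Rightarrow> real \<Rightarrow> real \<Rightarrow> bool" where
  "dyadic_interval T a c \<longleftrightarrow>
     (\<exists>n k. k < 2 ^ n \<and> a = dyadic_pt T n k \<and> c = dyadic_pt T n (k + 1))"

definition base_incr :: "(real \<Rightarrow> real \<Rightarrow> real \<Rightarrow> 'a::real_vector) \<Rightarrow> real \<Rightarrow> real \<Rightarrow> 'a" where
  "base_incr H t s = - H t s 0"

text \<open>
  A splitting rule \<open>sp\<close> takes the cocycle \<open>H\<close>, the endpoints \<open>a\<close>, \<open>c\<close> of a dyadic interval and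
  the residual \<open>Q\<^sub>c\<^sub>a\<close> it carries, and returns the pair \<open>(Q\<^sub>c\<^sub>b, Q\<^sub>b\<^sub>a)\<close> of child residuals. As \<open>H\<close> is
  an argument, the choice may depend on the whole course of the recursion.
\<close>

type_synonym 'a splitting_rule =
  "(real \<Rightarrow> real \<Rightarrow> real \<Rightarrow> 'a) \<Rightarrow> real \<Rightarrow> real \<Rightarrow> 'a \<Rightarrow> 'a \<times> 'a"

text \<open>\<open>dyadic_val T S sp H n k\<close> is the value of the path at \<open>dyadic_pt T n k\<close>.\<close>

fun dyadic_val ::
  "real \<Rightarrow> (real \<Rightarrow> 'a \<Rightarrow> 'a) \<Rightarrow> 'a splitting_rule \<Rightarrow> (real \<Rightarrow> real \<Rightarrow> real \<Rightarrow> 'a::real_vector)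
    \<Rightarrow> nat \<Rightarrow> nat \<Rightarrow> 'a" where
  "dyadic_val T S sp H 0 k = (if k = 0 then 0 else base_incr H T 0)"
| "dyadic_val T S sp H (Suc n) k =
     (let j = k div 2 in
      if even k then dyadic_val T S sp H n j
      else
        let a = dyadic_pt T n j; c = dyadic_pt T n (j + 1); b = (a + c) / 2;
            Ia = dyadic_val T S sp H n j; Ic = dyadic_val T S sp H n (j + 1);
            Q = base_incr H c a - Ic + S (c - a) Ia
        in base_incr H b a + S (b - a) Ia - snd (sp H a c Q))"

definition dyadic_path ::
  "real \<Rightarrow> (real \<Rightarrow> 'a \<Rightarrow> 'a) \<Rightarrow> 'a splitting_rule \<Rightarrow> (real \<Rightarrow> real \<Rightarrow> real \<Rightarrow> 'a::real_vector)
    \<Rightarrow> real \<Rightarrow> 'a" where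
  "dyadic_path T S sp H t =
     (THE x. \<exists>n k. k \<le> 2 ^ n \<and> t = dyadic_pt T n k \<and> x = dyadic_val T S sp H n k)"

definition residual ::
  "real \<Rightarrow> (real \<Rightarrow> 'a \<Rightarrow> 'a) \<Rightarrow> 'a splitting_rule \<Rightarrow> (real \<Rightarrow> real \<Rightarrow> real \<Rightarrow> 'a::real_vector)
    \<Rightarrow> real \<Rightarrow> real \<Rightarrow> 'a" where
  "residual T S sp H t s =
     base_incr H t s - dyadic_path T S sp H t + S (t - s) (dyadic_path T S sp H s)"

definition child_residuals ::
  "real \<Rightarrow> (real \<Rightarrow> 'a \<Rightarrow> 'a) \<Rightarrow> 'a splitting_rule \<Rightarrow> (real \<Rightarrow> real \<Rightarrow> real \<Rightarrow> 'a::real_vector)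
    \<Rightarrow> real \<Rightarrow> real \<Rightarrow> 'a \<times> 'a" where
  "child_residuals T S sp H a c = sp H a c (residual T S sp H c a)"

text \<open>The path does not depend on the level at which a dyadic point is represented, and it
  satisfies the defining recursion.\<close>

lemma dyadic_val_refine:
  "dyadic_val T S sp H (n + m) (2 ^ m * k) = dyadic_val T S sp H n k"
  by (induction m) (simp_all add: mult.assoc)

lemma dyadic_path_pt:
  assumes "T > 0" "k \<le> 2 ^ n"
  shows "dyadic_path T S sp H (dyadic_pt T n k) = dyadic_val T S sp H n k"
  unfolding dyadic_path_def
proof (rule the_equality)
  show "\<exists>n' k'. k' \<le> 2 ^ n' \<and> dyadic_pt T n k = dyadic_pt T n' k' \<and>
          dyadic_val T S sp H n k = dyadic_val T S sp H n' k'"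
    using assms by blast
next
  fix x
  assume "\<exists>n' k'. k' \<le> 2 ^ n' \<and> dyadic_pt T n k = dyadic_pt T n' k' \<and>
            x = dyadic_val T S sp H n' k'"
  then obtain n' k' where eq: "dyadic_pt T n k = dyadic_pt T n' k'"
    and x: "x = dyadic_val T S sp H n' k'" by blast
  from eq \<open>T > 0\<close> have "real k * 2 ^ n' = real k' * 2 ^ n"
    by (simp add: dyadic_pt_def field_simps)
  then have "real (2 ^ n' * k) = real (2 ^ n * k')"
    by (simp add: mult.commute)
  then have "2 ^ n' * k = 2 ^ n * k'"
    by (simp only: of_nat_eq_iff)
  then show "x = dyadic_val T S sp H n k"
    using dyadic_val_refine[of T S sp H n n' k] dyadic_val_refine[of T S sp H n' n k']
    by (simp add: x add.commute)
qed

lemma dyadic_path_rec: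
  assumes "T > 0"
  shows "dyadic_path T S sp H 0 = 0"
    and "dyadic_path T S sp H T = base_incr H T 0"
    and "dyadic_interval T a c \<Longrightarrow> b = (a + c) / 2 \<Longrightarrow>
      dyadic_path T S sp H b =
        base_incr H b a + S (b - a) (dyadic_path T S sp H a)
        - snd (child_residuals T S sp H a c)"
proof -
  show "dyadic_path T S sp H 0 = 0"
    using dyadic_path_pt[OF assms, of 0 0 S sp H] by (simp add: dyadic_pt_def)
  show "dyadic_path T S sp H T = base_incr H T 0"
    using dyadic_path_pt[OF assms, of 1 0 S sp H] by (simp add: dyadic_pt_def)
  assume "dyadic_interval T a c" and b: "b = (a + c) / 2"
  then obtain n k where k: "k < 2 ^ n" and a: "a = dyadic_pt T n k"
    and c: "c = dyadic_pt T n (k + 1)"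
    by (auto simp: dyadic_interval_def)
  have b': "b = dyadic_pt T (Suc n) (2 * k + 1)"
    using b a c by (simp add: dyadic_pt_def field_simps)
  have pa: "dyadic_path T S sp H a = dyadic_val T S sp H n k"
    using k unfolding a by (intro dyadic_path_pt assms) simp
  have pc: "dyadic_path T S sp H c = dyadic_val T S sp H n (k + 1)"
    using k unfolding c by (intro dyadic_path_pt assms) simp
  have pb: "dyadic_path T S sp H b = dyadic_val T S sp H (Suc n) (2 * k + 1)"
    using k unfolding b' by (intro dyadic_path_pt assms) simp
  show "dyadic_path T S sp H b = base_incr H b a + S (b - a) (dyadic_path T S sp H a)
          - snd (child_residuals T S sp H a c)"
    unfolding pb child_residuals_def residual_def pa pc
    by (simp add: Let_def b a c del: One_nat_def)
qed


section \<open>Admissible selection domains and the Sewing map\<close>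

definition linear_subspace3 :: "(real \<Rightarrow> real \<Rightarrow> real \<Rightarrow> 'a::real_vector) set \<Rightarrow> bool" where
  "linear_subspace3 D \<longleftrightarrow>
     (\<lambda>t u s. 0) \<in> D \<and>
     (\<forall>H\<in>D. \<forall>K\<in>D. (\<lambda>t u s. H t u s + K t u s) \<in> D) \<and>
     (\<forall>c. \<forall>H\<in>D. (\<lambda>t u s. c *\<^sub>R H t u s) \<in> D)"

definition linear_rule_on ::
  "real \<Rightarrow> (real \<Rightarrow> 'a \<Rightarrow> 'a) \<Rightarrow> 'a splitting_rule \<Rightarrow> (real \<Rightarrow> real \<Rightarrow> real \<Rightarrow> 'a::real_vector) set
    \<Rightarrow> bool" where
  "linear_rule_on T S sp D \<longleftrightarrow>
     (\<forall>a c. dyadic_interval T a c \<longrightarrow>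
        (\<forall>H\<in>D. \<forall>K\<in>D. child_residuals T S sp (\<lambda>t u s. H t u s + K t u s) a c =
                       child_residuals T S sp H a c + child_residuals T S sp K a c) \<and>
        (\<forall>r. \<forall>H\<in>D. child_residuals T S sp (\<lambda>t u s. r *\<^sub>R H t u s) a c =
                    r *\<^sub>R child_residuals T S sp H a c))"

text \<open>
  \<open>child_bound T V N S \<gamma> sp D f\<close>: both child residuals are bounded by
  \<open>f L \<cdot> \<parallel>Q\<^sub>c\<^sub>a\<parallel> + C\<^sub>H L\<^sup>\<gamma>\<close> with \<open>L = c - a\<close>, where \<open>C\<^sub>H \<le> C\<^sub>s \<parallel>H\<parallel>\<close> and \<open>C\<^sub>s\<close> does not depend on
  \<open>H\<close>. The norm of \<open>H\<close> is finite on the cocycle space, so \<^const>\<open>enn2real\<close> is harmless.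
\<close>

definition child_bound ::
  "real \<Rightarrow> 'a::real_vector set \<Rightarrow> ('a \<Rightarrow> real) \<Rightarrow> (real \<Rightarrow> 'a \<Rightarrow> 'a) \<Rightarrow> real \<Rightarrow> 'a splitting_rule
    \<Rightarrow> (real \<Rightarrow> real \<Rightarrow> real \<Rightarrow> 'a) set \<Rightarrow> (real \<Rightarrow> real) \<Rightarrow> bool" where
  "child_bound T V N S \<gamma> sp D f \<longleftrightarrow>
     (\<exists>C\<^sub>s. \<forall>H\<in>D. \<exists>C\<^sub>H. C\<^sub>H \<le> C\<^sub>s * enn2real (norm3 T V N \<gamma> H) \<and>
        (\<forall>a c. dyadic_interval T a c \<longrightarrow>
           max (N (fst (child_residuals T S sp H a c))) (N (snd (child_residuals T S sp H a c)))
           \<le> f (c - a) * N (residual T S sp H c a) + C\<^sub>H * (c - a) powr \<gamma>))"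

definition admissible_domain ::
  "real \<Rightarrow> 'a::real_vector set \<Rightarrow> ('a \<Rightarrow> real) \<Rightarrow> (real \<Rightarrow> 'a \<Rightarrow> 'a) \<Rightarrow> real \<Rightarrow> 'a splitting_rule
    \<Rightarrow> (real \<Rightarrow> real \<Rightarrow> real \<Rightarrow> 'a) set \<Rightarrow> bool" where
  "admissible_domain T V N S \<gamma> sp D \<longleftrightarrow>
     D \<subseteq> cocycles T V N S \<gamma> \<and> linear_subspace3 D \<and> linear_rule_on T S sp D \<and>
     (\<forall>H\<in>D. \<forall>a c. dyadic_interval T a c \<longrightarrow>
        (let b = (a + c) / 2; Qcb = fst (child_residuals T S sp H a c);
             Qba = snd (child_residuals T S sp H a c)
         in Qcb \<in> V \<and> Qba \<in> V \<and>
            residual T S sp H c a = Qcb + S (c - b) Qba + H c b a)) \<and>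
     (0 < \<gamma> \<and> \<gamma> < 1 \<longrightarrow> (\<exists>\<theta> < 2 powr (- \<gamma>). child_bound T V N S \<gamma> sp D (\<lambda>L. \<theta>))) \<and>
     (\<gamma> = 1 \<longrightarrow> (\<exists>C>0. \<exists>\<eta>>0. child_bound T V N S \<gamma> sp D (\<lambda>L. 1 / 2 + C * L powr \<eta>))) \<and>
     (\<forall>H\<in>D. ((\<lambda>h. SUP (t, s) \<in> {(t, s). s \<le> t \<and> s \<in> dyadics T \<and> t \<in> dyadics T \<and> t + h \<le> T}.
                 ennreal (N (S h (residual T S sp H t s) - residual T S sp H t s)))
              \<longlongrightarrow> 0) (at_right 0))"

text \<open>The unique continuous extension of the dyadic residual to the whole simplex.\<close>

definition sewing_map ::
  "real \<Rightarrow> 'a::real_vector set \<Rightarrow> ('a \<Rightarrow> real) \<Rightarrow> (real \<Rightarrow> 'a \<Rightarrow> 'a) \<Rightarrow> 'a splitting_rule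
    \<Rightarrow> (real \<Rightarrow> real \<Rightarrow> real \<Rightarrow> 'a) \<Rightarrow> real \<Rightarrow> real \<Rightarrow> 'a" where
  "sewing_map T V N S sp H =
     (THE R. R \<in> cincr2 T V N \<and>
        (\<forall>t\<in>dyadics T. \<forall>s\<in>dyadics T. s \<le> t \<longrightarrow> R t s = residual T S sp H t s))"

definition sewn_incr ::
  "real \<Rightarrow> 'a::real_vector set \<Rightarrow> ('a \<Rightarrow> real) \<Rightarrow> (real \<Rightarrow> 'a \<Rightarrow> 'a) \<Rightarrow> 'a splitting_rule
    \<Rightarrow> (real \<Rightarrow> real \<Rightarrow> 'a) \<Rightarrow> real \<Rightarrow> real \<Rightarrow> 'a" where
  "sewn_incr T V N S sp A = (\<lambda>t s. A t s - sewing_map T V N S sp (delta2 T S A) t s)"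

definition sewn_path ::
  "real \<Rightarrow> 'a::real_vector set \<Rightarrow> ('a \<Rightarrow> real) \<Rightarrow> (real \<Rightarrow> 'a \<Rightarrow> 'a) \<Rightarrow> 'a splitting_rule
    \<Rightarrow> (real \<Rightarrow> real \<Rightarrow> 'a) \<Rightarrow> real \<Rightarrow> 'a" where
  "sewn_path T V N S sp A = (\<lambda>t. sewn_incr T V N S sp A t 0)"

end

theory Submission
  imports Defs
begin

text \<open>
  Write \<open>H\<close> for the coboundary of \<open>A\<close>. Suppose that the sewing map applied to \<open>H\<close> has the form
  \<open>\<Lambda>\<^sub>t\<^sub>s = - H t s 0 - J t + S (t - s) (J s)\<close> for some continuous path \<open>J\<close> with \<open>J 0 = 0\<close>. Expanding
  \<open>H t s 0 = A t 0 - A t s - S (t - s) (A s 0)\<close> then gives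
  \<open>A t s - \<Lambda>\<^sub>t\<^sub>s = Y t - S (t - s) (Y s)\<close> with \<open>Y t = A t 0 + J t\<close>, so \<open>A - \<Lambda>\<close> is a coboundary. The
  degenerate values \<open>A 0 0 = 0\<close> and \<open>H t 0 0 = 0\<close> identify \<open>Y t\<close> with \<open>A t 0 - \<Lambda>\<^sub>t\<^sub>0\<close>, and uniqueness
  follows by taking \<open>s = 0\<close> in the equation.

  The substance is therefore the existence of \<open>J\<close> (\<open>sewing_map_representation\<close>), which
  amounts to the uniform continuity of the dyadic path, as dyadic times are dense and the space is
  complete.

  The residual \<open>R\<close> of the dyadic path has coboundary \<open>H\<close> (\<open>residual_coboundary\<close>), so the
  child residuals chosen by the rule are values of \<open>R\<close> on the two halves of an interval. The
  admissibility bound contracts them by a factor below \<open>1\<close> on fine levels, up to a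
  geometrically decaying error; hence the largest residuals over the intervals of each level form a
  summable sequence (\<open>level_residuals_summable\<close>). Chaining over levels bounds \<open>R\<close> between
  arbitrary dyadic times by a tail of that series and of a series of cocycle errors
  (\<open>residual_chain\<close>); the latter converges because a cocycle of finite norm is small as soon as
  one of its two gaps is small (\<open>cocycle_decay\<close>). So \<open>R t s\<close> tends to \<open>0\<close> with \<open>t - s\<close>, uniformly.

  Finally \<open>I t - I s = - H t s 0 - R t s - (S (t - s) (R s 0) - R s 0)\<close> for the dyadic path \<open>I\<close>: the
  first term is small by the decay of \<open>H\<close>, the second by chaining, and the third by the
  equicontinuity condition in the definition of an admissible domain.
\<close>

section \<open>Banach spaces carried by a subset\<close>

locale banach_carrier =
  fixes V :: "'a::real_vector set" and N :: "'a \<Rightarrow> real"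
  assumes banach: "banach_on V N"
begin

lemma
  shows subspace_V: "subspace V"
    and norm_nonneg: "x \<in> V \<Longrightarrow> 0 \<le> N x"
    and norm_eq_0_iff: "x \<in> V \<Longrightarrow> N x = 0 \<longleftrightarrow> x = 0"
    and norm_scaleR: "x \<in> V \<Longrightarrow> N (c *\<^sub>R x) = \<bar>c\<bar> * N x"
    and norm_add_le: "x \<in> V \<Longrightarrow> y \<in> V \<Longrightarrow> N (x + y) \<le> N x + N y"
    and complete: "Metric_space.mcomplete V (ndist V N)"
  using banach by (auto simp: banach_on_def)

lemma
  shows zero_mem [simp]: "0 \<in> V"
    and add_mem [simp]: "x \<in> V \<Longrightarrow> y \<in> V \<Longrightarrow> x + y \<in> V"
    and diff_mem [simp]: "x \<in> V \<Longrightarrow> y \<in> V \<Longrightarrow> x - y \<in> V"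
    and uminus_mem [simp]: "x \<in> V \<Longrightarrow> - x \<in> V"
    and scaleR_mem [simp]: "x \<in> V \<Longrightarrow> c *\<^sub>R x \<in> V"
  using subspace_V
  by (auto simp: subspace_def subspace_diff subspace_neg)

lemma norm_zero [simp]: "N 0 = 0"
  using norm_eq_0_iff by simp

lemma norm_uminus: "x \<in> V \<Longrightarrow> N (- x) = N x"
  using norm_scaleR[of x "-1"] by simp

lemma norm_diff_commute: "x \<in> V \<Longrightarrow> y \<in> V \<Longrightarrow> N (x - y) = N (y - x)"
  using norm_uminus[of "x - y"] by simp

lemma norm_diff_le: "x \<in> V \<Longrightarrow> y \<in> V \<Longrightarrow> N (x - y) \<le> N x + N y"
  using norm_add_le[of x "- y"] norm_uminus[of y] by simp

lemma norm_diff_triangle: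
  "x \<in> V \<Longrightarrow> y \<in> V \<Longrightarrow> z \<in> V \<Longrightarrow> N (x - z) \<le> N (x - y) + N (y - z)"
  using norm_add_le[of "x - y" "y - z"] by simp

sublocale Metric_space V "ndist V N"
proof
  fix x y z
  show "0 \<le> ndist V N x y"
    by (simp add: ndist_def norm_nonneg)
  show "ndist V N x y = ndist V N y x"
    by (simp add: ndist_def norm_diff_commute)
  show "x \<in> V \<Longrightarrow> y \<in> V \<Longrightarrow> (ndist V N x y = 0) = (x = y)"
    by (simp add: ndist_def norm_eq_0_iff)
  show "x \<in> V \<Longrightarrow> y \<in> V \<Longrightarrow> z \<in> V \<Longrightarrow> ndist V N x z \<le> ndist V N x y + ndist V N y z"
    by (simp add: ndist_def norm_diff_triangle)
qed

lemma continuous_map_iff: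
  fixes X :: "'b::metric_space set"
  shows "continuous_map (top_of_set X) (ntopology V N) f \<longleftrightarrow>
    f \<in> X \<rightarrow> V \<and> (\<forall>x\<in>X. \<forall>e>0. \<exists>d>0. \<forall>y\<in>X. dist y x < d \<longrightarrow> N (f y - f x) < e)"
    (is "?L \<longleftrightarrow> ?R")
proof
  assume L: ?L
  show ?R
  proof (intro conjI ballI allI impI)
    show f: "f \<in> X \<rightarrow> V"
      using L by (auto simp: continuous_map_def ntopology_def)
    fix x and e :: real assume "x \<in> X" "e > 0"
    then obtain U where U: "openin (top_of_set X) U" "x \<in> U" "\<And>y. y \<in> U \<Longrightarrow> f y \<in> mball (f x) e"
      using L unfolding ntopology_def continuous_map_to_metric by (simp del: in_mball) meson
    then obtain d where "d > 0" "\<And>y. y \<in> X \<Longrightarrow> dist y x < d \<Longrightarrow> y \<in> U"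
      unfolding openin_euclidean_subtopology_iff by metis
    then show "\<exists>d>0. \<forall>y\<in>X. dist y x < d \<longrightarrow> N (f y - f x) < e"
      using U f \<open>x \<in> X\<close> by (fastforce simp: ndist_def norm_diff_commute Pi_iff)
  qed
next
  assume R: ?R
  show ?L
    unfolding ntopology_def continuous_map_to_metric
  proof (intro ballI allI impI)
    fix x and e :: real assume "x \<in> topspace (top_of_set X)" "e > 0"
    then have x: "x \<in> X" by simp
    then obtain d where d: "d > 0" "\<And>y. y \<in> X \<Longrightarrow> dist y x < d \<Longrightarrow> N (f y - f x) < e"
      using R \<open>e > 0\<close> by blast
    have "openin (top_of_set X) (X \<inter> ball x d)"
      by (simp add: openin_open_Int)
    moreover have "x \<in> X \<inter> ball x d" using x d by simp
    moreover have "\<forall>y\<in>X \<inter> ball x d. f y \<in> mball (f x) e"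
    proof
      fix y assume y: "y \<in> X \<inter> ball x d"
      then have "N (f y - f x) < e" using d by (auto simp: dist_commute)
      moreover have "f y \<in> V" "f x \<in> V" using R x y by auto
      ultimately show "f y \<in> mball (f x) e"
        by (simp add: ndist_def norm_diff_commute)
    qed
    ultimately show "\<exists>U. openin (top_of_set X) U \<and> x \<in> U \<and> (\<forall>y\<in>U. f y \<in> mball (f x) e)"
      by blast
  qed
qed

lemma continuous_map_diff:
  fixes X :: "'b::metric_space set"
  assumes f: "continuous_map (top_of_set X) (ntopology V N) f"
    and g: "continuous_map (top_of_set X) (ntopology V N) g"
  shows "continuous_map (top_of_set X) (ntopology V N) (\<lambda>x. f x - g x)"
  unfolding continuous_map_iff
proof (intro conjI ballI allI impI)
  have V: "f x \<in> V" "g x \<in> V" if "x \<in> X" for x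
    using f g that unfolding continuous_map_iff by auto
  then show "(\<lambda>x. f x - g x) \<in> X \<rightarrow> V" by simp
  fix x and e :: real assume x: "x \<in> X" and "e > 0"
  then have "e / 2 > 0" by simp
  obtain d1 where d1: "d1 > 0" "\<forall>y\<in>X. dist y x < d1 \<longrightarrow> N (f y - f x) < e / 2"
    using f x \<open>e / 2 > 0\<close> unfolding continuous_map_iff by meson
  obtain d2 where d2: "d2 > 0" "\<forall>y\<in>X. dist y x < d2 \<longrightarrow> N (g y - g x) < e / 2"
    using g x \<open>e / 2 > 0\<close> unfolding continuous_map_iff by meson
  have "N ((f y - g y) - (f x - g x)) < e" if y: "y \<in> X" "dist y x < min d1 d2" for y
  proof -
    have "N ((f y - f x) - (g y - g x)) \<le> N (f y - f x) + N (g y - g x)"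
      using V x y by (intro norm_diff_le) auto
    also have "\<dots> < e / 2 + e / 2"
      using d1 d2 y by (intro add_strict_mono) auto
    finally show ?thesis by (simp add: algebra_simps)
  qed
  then show "\<exists>d>0. \<forall>y\<in>X. dist y x < d \<longrightarrow> N ((f y - g y) - (f x - g x)) < e"
    using d1 d2 by (intro exI[of _ "min d1 d2"]) auto
qed

lemma continuous_map_uminus:
  fixes X :: "'b::metric_space set"
  assumes "continuous_map (top_of_set X) (ntopology V N) f"
  shows "continuous_map (top_of_set X) (ntopology V N) (\<lambda>x. - f x)"
  using continuous_map_diff[OF _ assms, of "\<lambda>x. 0"] by (simp add: ntopology_def)

lemma continuous_map_add:
  fixes X :: "'b::metric_space set"
  assumes "continuous_map (top_of_set X) (ntopology V N) f"
    and "continuous_map (top_of_set X) (ntopology V N) g"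
  shows "continuous_map (top_of_set X) (ntopology V N) (\<lambda>x. f x + g x)"
  using continuous_map_diff[OF assms(1) continuous_map_uminus[OF assms(2)]] by simp

lemma continuous_on_norm:
  fixes X :: "'b::metric_space set"
  assumes "continuous_map (top_of_set X) (ntopology V N) f"
  shows "continuous_on X (\<lambda>x. N (f x))"
  unfolding continuous_on_iff
proof (intro ballI allI impI)
  fix x and e :: real assume x: "x \<in> X" and "e > 0"
  then obtain d where d: "d > 0" "\<forall>y\<in>X. dist y x < d \<longrightarrow> N (f y - f x) < e"
    using assms unfolding continuous_map_iff by meson
  have V: "f y \<in> V" if "y \<in> X" for y
    using assms that unfolding continuous_map_iff by auto
  have "dist (N (f y)) (N (f x)) < e" if y: "y \<in> X" "dist y x < d" for y
    using norm_add_le[of "f y - f x" "f x"] norm_add_le[of "f x - f y" "f y"]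
      norm_diff_commute[of "f x" "f y"] V[OF x] V[OF y(1)] d y
    by (force simp: dist_real_def)
  then show "\<exists>d>0. \<forall>y\<in>X. dist y x < d \<longrightarrow> dist (N (f y)) (N (f x)) < e"
    using d by blast
qed

text \<open>The uniform boundedness principle. By Baire's theorem one of the closed sets
  \<open>E n\<close> of points with all images bounded by \<open>n\<close> contains a ball, and by linearity
  the bound on that ball gives a bound on the unit ball.\<close>

lemma uniform_boundedness:
  assumes bdd: "\<And>j. j \<in> J \<Longrightarrow> bounded_operator_on V N (f j)"
    and pointwise: "\<And>x. x \<in> V \<Longrightarrow> \<exists>c. \<forall>j\<in>J. N (f j x) \<le> c"
  shows "\<exists>M\<ge>0. \<forall>j\<in>J. \<forall>x\<in>V. N (f j x) \<le> M * N x"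
proof -
  have f: "f j x \<in> V" "f j (x + y) = f j x + f j y" "f j (c *\<^sub>R x) = c *\<^sub>R f j x"
    if "j \<in> J" "x \<in> V" "y \<in> V" for j x y c
    using bdd[OF that(1)] that unfolding bounded_operator_on_def by auto
  define E where "E n = {x \<in> V. \<forall>j\<in>J. N (f j x) \<le> real n}" for n
  have closed: "closedin mtopology (E n)" for n
    unfolding closedin_metric
  proof (intro conjI allI impI)
    show "E n \<subseteq> V" by (auto simp: E_def)
    fix x assume "x \<in> V - E n"
    then obtain j where x: "x \<in> V" and j: "j \<in> J" "real n < N (f j x)"
      by (auto simp: E_def not_le)
    obtain K where K: "\<And>y. y \<in> V \<Longrightarrow> N (f j y) \<le> K * N y"
      using bdd[OF j(1)] unfolding bounded_operator_on_def by blast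
    define r where "r = (N (f j x) - n) / (\<bar>K\<bar> + 1)"
    have "r > 0" using j by (simp add: r_def)
    moreover have "y \<notin> E n" if y: "y \<in> mball x r" for y
    proof
      assume "y \<in> E n"
      then have yV: "y \<in> V" and "N (f j y) \<le> n" using j by (auto simp: E_def)
      have "N (f j x) \<le> N (f j (x - y)) + N (f j y)"
        using norm_add_le[of "f j (x - y)" "f j y"] f(1)[OF j(1)] f(2)[OF j(1), of "x - y" y] x yV
        by simp
      also have "N (f j (x - y)) \<le> \<bar>K\<bar> * N (x - y)"
        using K[of "x - y"] x yV norm_nonneg[of "x - y"]
        by (smt (verit) diff_mem mult_right_mono)
      also have "\<dots> \<le> \<bar>K\<bar> * r"
        using y x yV by (intro mult_left_mono) (auto simp: ndist_def)
      also have "\<dots> < (\<bar>K\<bar> + 1) * r" using \<open>r > 0\<close> by simp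
      also have "\<dots> = N (f j x) - n" by (simp add: r_def)
      finally show False using \<open>N (f j y) \<le> n\<close> by simp
    qed
    ultimately show "\<exists>r>0. disjnt (E n) (mball x r)"
      by (intro exI[of _ r]) (auto simp: disjnt_def)
  qed
  have "\<Union>(range E) = V"
  proof (intro equalityI subsetI)
    fix x assume x: "x \<in> V"
    then obtain c where "\<forall>j\<in>J. N (f j x) \<le> c" using pointwise by blast
    moreover obtain n where "c \<le> real n" using real_arch_simple by blast
    ultimately show "x \<in> \<Union>(range E)"
      using x by (auto simp: E_def intro!: exI[of _ n] order_trans[of _ c "real n"])
  qed (auto simp: E_def)
  moreover have "mtopology interior_of V \<noteq> {}"
    using interior_of_topspace[of mtopology] zero_mem by (metis empty_iff topspace_mtopology)
  ultimately obtain n where "mtopology interior_of (E n) \<noteq> {}"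
    using metric_Baire_category_alt[OF complete, of "range E"] closed by auto
  then obtain x0 \<epsilon> where x0: "x0 \<in> V" and "\<epsilon> > 0" and ball: "mball x0 \<epsilon> \<subseteq> E n"
    unfolding metric_interior_of by blast
  have "N (f j x) \<le> 4 * n / \<epsilon> * N x" if j: "j \<in> J" and x: "x \<in> V" for j x
  proof (cases "x = 0")
    case True
    then show ?thesis using f(3)[OF j zero_mem zero_mem, of 0] by simp
  next
    case False
    then have Nx: "N x > 0" using norm_nonneg[OF x] norm_eq_0_iff[OF x] by linarith
    \<comment> \<open>Scaled so that \<open>x0 + c *\<^sub>R x\<close> stays inside the ball.\<close>
    define c where "c = \<epsilon> / (2 * N x)"
    have "c > 0" using \<open>\<epsilon> > 0\<close> Nx by (simp add: c_def)
    have "N (c *\<^sub>R x) < \<epsilon>"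
      using \<open>\<epsilon> > 0\<close> Nx x by (simp add: norm_scaleR c_def)
    then have "N (x0 - (x0 + c *\<^sub>R x)) < \<epsilon>"
      using x norm_uminus[of "c *\<^sub>R x"] by simp
    then have "x0 + c *\<^sub>R x \<in> E n" "x0 \<in> E n"
      using ball x0 x \<open>\<epsilon> > 0\<close> by (auto simp: ndist_def subset_iff)
    then have le: "N (f j (x0 + c *\<^sub>R x)) \<le> n" "N (f j x0) \<le> n"
      using j by (auto simp: E_def)
    have "f j (x0 + c *\<^sub>R x) - f j x0 = c *\<^sub>R f j x"
      using f(2)[OF j x0, of "c *\<^sub>R x"] f(3)[OF j x x] x by simp
    then have "c * N (f j x) = N (f j (x0 + c *\<^sub>R x) - f j x0)"
      using \<open>c > 0\<close> f(1)[OF j x x] by (simp add: norm_scaleR)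
    also have "\<dots> \<le> n + n"
      using norm_diff_le[of "f j (x0 + c *\<^sub>R x)" "f j x0"] le f(1)[OF j] x0 x by force
    finally show ?thesis
      using Nx \<open>\<epsilon> > 0\<close> by (simp add: c_def field_simps)
  qed
  then show ?thesis
    using \<open>\<epsilon> > 0\<close> by (intro exI[of _ "4 * n / \<epsilon>"]) auto
qed

end

section \<open>Strongly continuous semigroups\<close>

locale c0_semigroup = banach_carrier V N
  for V :: "'a::real_vector set" and N :: "'a \<Rightarrow> real" +
  fixes S :: "real \<Rightarrow> 'a \<Rightarrow> 'a"
  assumes semigroup: "c0_semigroup_on V N S"
begin

lemma
  shows bounded_operator: "t \<ge> 0 \<Longrightarrow> bounded_operator_on V N (S t)"
    and S_id: "x \<in> V \<Longrightarrow> S 0 x = x"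
    and S_compose: "t \<ge> 0 \<Longrightarrow> s \<ge> 0 \<Longrightarrow> x \<in> V \<Longrightarrow> S t (S s x) = S (t + s) x"
    and S_orbit: "x \<in> V \<Longrightarrow> continuous_map (top_of_set {0..}) (ntopology V N) (\<lambda>t. S t x)"
  using semigroup by (auto simp: c0_semigroup_on_def)

lemma
  assumes "t \<ge> 0"
  shows S_mem [simp]: "x \<in> V \<Longrightarrow> S t x \<in> V"
    and S_add: "x \<in> V \<Longrightarrow> y \<in> V \<Longrightarrow> S t (x + y) = S t x + S t y"
    and S_scaleR: "x \<in> V \<Longrightarrow> S t (c *\<^sub>R x) = c *\<^sub>R S t x"
  using bounded_operator[OF assms] by (auto simp: bounded_operator_on_def)

lemma S_uminus: "t \<ge> 0 \<Longrightarrow> x \<in> V \<Longrightarrow> S t (- x) = - S t x"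
  using S_scaleR[of t x "-1"] by simp

lemma S_diff: "t \<ge> 0 \<Longrightarrow> x \<in> V \<Longrightarrow> y \<in> V \<Longrightarrow> S t (x - y) = S t x - S t y"
  using S_add[of t x "- y"] S_uminus[of t y] by simp

lemma S_zero [simp]: "t \<ge> 0 \<Longrightarrow> S t 0 = 0"
  using S_scaleR[of t 0 0] by simp

lemma locally_bounded: "\<exists>M\<ge>0. \<forall>t\<in>{0..T}. \<forall>x\<in>V. N (S t x) \<le> M * N x"
proof (rule uniform_boundedness)
  show "bounded_operator_on V N (S t)" if "t \<in> {0..T}" for t
    using that bounded_operator by simp
  fix x assume "x \<in> V"
  then have "continuous_on {0..} (\<lambda>t. N (S t x))"
    by (intro continuous_on_norm S_orbit)
  then have "continuous_on {0..T} (\<lambda>t. N (S t x))"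
    by (rule continuous_on_subset) auto
  then have "bounded ((\<lambda>t. N (S t x)) ` {0..T})"
    by (intro compact_imp_bounded compact_continuous_image) auto
  then show "\<exists>c. \<forall>t\<in>{0..T}. N (S t x) \<le> c"
    unfolding bounded_iff by (auto intro: abs_le_D1)
qed

text \<open>Strong continuity and local boundedness make the action jointly continuous.\<close>

lemma continuous_map_action:
  fixes X :: "'b::metric_space set"
  assumes f: "continuous_map (top_of_set X) (ntopology V N) f"
    and r: "continuous_on X r" and rT: "\<And>x. x \<in> X \<Longrightarrow> r x \<in> {0..T}"
  shows "continuous_map (top_of_set X) (ntopology V N) (\<lambda>x. S (r x) (f x))"
  unfolding continuous_map_iff
proof (intro conjI ballI allI impI)
  obtain M where M: "M \<ge> 0" "\<And>t x. t \<in> {0..T} \<Longrightarrow> x \<in> V \<Longrightarrow> N (S t x) \<le> M * N x"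
    using locally_bounded by blast
  have V: "f x \<in> V" "r x \<ge> 0" if "x \<in> X" for x
    using f that rT[OF that] unfolding continuous_map_iff by auto
  then show "(\<lambda>x. S (r x) (f x)) \<in> X \<rightarrow> V" by simp
  fix x and e :: real assume x: "x \<in> X" and "e > 0"
  have pos: "e / 2 > 0" "e / (2 * (M + 1)) > 0" using \<open>e > 0\<close> M by auto
  obtain d1 where d1: "d1 > 0" "\<forall>y\<in>X. dist y x < d1 \<longrightarrow> N (f y - f x) < e / (2 * (M + 1))"
    using f x pos unfolding continuous_map_iff by meson
  obtain d2 where d2: "d2 > 0"
    "\<forall>t\<in>{0..}. dist t (r x) < d2 \<longrightarrow> N (S t (f x) - S (r x) (f x)) < e / 2"
    using S_orbit[OF V(1)[OF x]] V(2)[OF x] pos unfolding continuous_map_iff by (meson atLeast_iff)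
  obtain d3 where d3: "d3 > 0" "\<forall>y\<in>X. dist y x < d3 \<longrightarrow> dist (r y) (r x) < d2"
    using r x d2(1) unfolding continuous_on_iff by meson
  have "N (S (r y) (f y) - S (r x) (f x)) < e" if y: "y \<in> X" "dist y x < min d1 d3" for y
  proof -
    note mem = V[OF x] V[OF y(1)]
    have "N (S (r y) (f y) - S (r y) (f x)) = N (S (r y) (f y - f x))"
      using mem by (simp add: S_diff)
    also have "\<dots> \<le> M * N (f y - f x)"
      using M(2) rT[OF y(1)] mem by simp
    also have "\<dots> \<le> (M + 1) * (e / (2 * (M + 1)))"
      using d1 y M mem norm_nonneg by (intro mult_mono) (auto intro: less_imp_le)
    also have "\<dots> = e / 2" using M by (auto simp: divide_simps)
    finally have "N (S (r y) (f y) - S (r y) (f x)) \<le> e / 2" .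
    moreover have "N (S (r y) (f x) - S (r x) (f x)) < e / 2"
      using d2 d3 y V by auto
    moreover have "N (S (r y) (f y) - S (r x) (f x)) \<le>
        N (S (r y) (f y) - S (r y) (f x)) + N (S (r y) (f x) - S (r x) (f x))"
      using mem by (intro norm_diff_triangle) auto
    ultimately show ?thesis by linarith
  qed
  then show "\<exists>d>0. \<forall>y\<in>X. dist y x < d \<longrightarrow> N (S (r y) (f y) - S (r x) (f x)) < e"
    using d1 d3 by (intro exI[of _ "min d1 d3"]) auto
qed

end

section \<open>Cocycles\<close>

text \<open>On a bounded range, lowering the exponent of the smaller factor to \<open>c\<close> and dropping the
  larger factor altogether costs only a constant.\<close>

lemma powr_product_le_powr_min:
  fixes x y a b c D :: real
  assumes "0 < x" "0 < y" "x \<le> D" "y \<le> D" "1 \<le> D" "0 < c" "c \<le> a" "c \<le> b"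
  shows "x powr a * y powr b \<le> D powr (a + b) * min x y powr c"
proof -
  have small: "z powr p \<le> D powr p * z powr c" if "0 < z" "z \<le> D" "c \<le> p" for z p
  proof -
    have "z powr p = z powr (p - c) * z powr c" by (simp flip: powr_add)
    also have "z powr (p - c) \<le> D powr (p - c)" using that by (intro powr_mono2) auto
    also have "\<dots> \<le> D powr p" using assms by (intro powr_mono) auto
    finally show ?thesis by (simp add: mult_right_mono)
  qed
  have large: "z powr p \<le> D powr p" if "0 < z" "z \<le> D" "c \<le> p" for z p
    using that assms by (intro powr_mono2) auto
  show ?thesis
  proof (cases "x \<le> y")
    case True
    have "x powr a * y powr b \<le> (D powr a * x powr c) * D powr b"
      using assms by (intro mult_mono small large) auto
    then show ?thesis using True by (simp add: powr_add mult_ac)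
  next
    case False
    have "x powr a * y powr b \<le> D powr a * (D powr b * y powr c)"
      using assms by (intro mult_mono small large) auto
    then show ?thesis using False by (simp add: powr_add mult_ac)
  qed
qed

context banach_carrier
begin

lemma norm_sum_le:
  assumes "finite J" "\<And>j. j \<in> J \<Longrightarrow> f j \<in> V"
  shows "(\<Sum>j\<in>J. f j) \<in> V \<and> N (\<Sum>j\<in>J. f j) \<le> (\<Sum>j\<in>J. N (f j))"
  using assms
proof (induction J)
  case (insert j J)
  then show ?case using norm_add_le[of "f j" "\<Sum>j\<in>J. f j"] by auto
qed simp

lemma cincr3_mem:
  assumes "h \<in> cincr3 T V N"
  shows "h t u s \<in> V"
proof (cases "(t, u, s) \<in> simplex3 T")
  case True
  have "(\<lambda>(t, u, s). h t u s) \<in> simplex3 T \<rightarrow> V"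
    using assms unfolding cincr3_def continuous_map_iff by auto
  from funcset_mem[OF this True] show ?thesis by simp
next
  case False
  then show ?thesis using assms by (simp add: cincr3_def)
qed

lemma cincr2_mem:
  assumes "g \<in> cincr2 T V N"
  shows "g t s \<in> V"
proof (cases "(t, s) \<in> simplex2 T")
  case True
  have "(\<lambda>(t, s). g t s) \<in> simplex2 T \<rightarrow> V"
    using assms unfolding cincr2_def continuous_map_iff by auto
  from funcset_mem[OF this True] show ?thesis by simp
next
  case False
  then show ?thesis using assms by (simp add: cincr2_def)
qed

text \<open>Since every exponent in a decomposition lies strictly between \<open>0\<close> and \<open>\<gamma>\<close>, a finite
  norm forces decay in the shorter of the two gaps. It is this decay, and not the
  homogeneity \<open>\<gamma>\<close> in \<open>t - s\<close>, that makes the errors of the chaining argument summable.\<close>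

lemma norm3_finite_imp_decay:
  assumes "norm3 T V N \<gamma> h < \<infinity>" "0 < \<gamma>"
  shows "\<exists>K\<ge>0. \<exists>\<rho>>0. \<forall>t u s. (t, u, s) \<in> simplex3 T \<and> s < u \<and> u < t \<longrightarrow>
           N (h t u s) \<le> K * min (t - u) (u - s) powr \<rho>"
proof -
  let ?P = "{(t, u, s). (t, u, s) \<in> simplex3 T \<and> s < u \<and> u < t}"
  let ?q = "\<lambda>hs \<rho> j t u s. N (hs j t u s) / (\<bar>t - u\<bar> powr \<rho> j * \<bar>u - s\<bar> powr (\<gamma> - \<rho> j))"
  have "\<exists>(m::nat) hs \<rho>. (\<forall>j<m. hs j \<in> cincr3 T V N \<and> 0 < \<rho> j \<and> \<rho> j < \<gamma>) \<and>
      h = (\<lambda>t u s. \<Sum>j<m. hs j t u s) \<and>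
      (\<Sum>j<m. SUP (t, u, s) \<in> ?P. ennreal (?q hs \<rho> j t u s)) < \<infinity>"
    using assms(1) unfolding norm3_def Inf_less_iff by blast
  then obtain m hs \<rho> where j: "\<And>j. j < (m::nat) \<Longrightarrow> hs j \<in> cincr3 T V N \<and> 0 < \<rho> j \<and> \<rho> j < \<gamma>"
    and h: "h = (\<lambda>t u s. \<Sum>j<m. hs j t u s)"
    and fin: "(\<Sum>j<m. SUP (t, u, s) \<in> ?P. ennreal (?q hs \<rho> j t u s)) < \<infinity>"
    by blast
  have "\<exists>c\<ge>0. \<forall>t u s. (t, u, s) \<in> ?P \<longrightarrow> ?q hs \<rho> j t u s \<le> c" if j: "j < m" for j
  proof -
    define X where "X = (SUP (t, u, s) \<in> ?P. ennreal (?q hs \<rho> j t u s))"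
    have "X < \<infinity>"
      using fin j unfolding X_def by (subst (asm) infinity_ennreal_def, subst (asm) ennreal_sum_less_top) auto
    then obtain c where c: "c \<ge> 0" "X = ennreal c"
      by (cases X) auto
    have "?q hs \<rho> j t u s \<le> c" if "(t, u, s) \<in> ?P" for t u s
      using SUP_upper[OF that, of "\<lambda>(t, u, s). ennreal (?q hs \<rho> j t u s)"] c
      unfolding X_def[symmetric] by (simp add: ennreal_le_iff)
    then show ?thesis using c by blast
  qed
  then have "\<exists>c. \<forall>j<m. c j \<ge> 0 \<and> (\<forall>t u s. (t, u, s) \<in> ?P \<longrightarrow> ?q hs \<rho> j t u s \<le> c j)"
    by (intro choice) blast
  then obtain c where c: "\<And>j. j < m \<Longrightarrow> c j \<ge> 0"
    "\<And>j t u s. j < m \<Longrightarrow> (t, u, s) \<in> ?P \<Longrightarrow> ?q hs \<rho> j t u s \<le> c j"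
    by blast
  \<comment> \<open>A common lower bound for all exponents; \<open>\<gamma>\<close> keeps the set nonempty when \<open>m = 0\<close>.\<close>
  define \<sigma> where "\<sigma> = Min (insert \<gamma> ((\<lambda>j. min (\<rho> j) (\<gamma> - \<rho> j)) ` {..<m}))"
  have \<sigma>: "0 < \<sigma>" "\<And>j. j < m \<Longrightarrow> \<sigma> \<le> \<rho> j \<and> \<sigma> \<le> \<gamma> - \<rho> j"
  proof -
    show "0 < \<sigma>" using j \<open>0 < \<gamma>\<close> by (auto simp: \<sigma>_def)
    fix i assume "i < m"
    then have "\<sigma> \<le> min (\<rho> i) (\<gamma> - \<rho> i)"
      unfolding \<sigma>_def by (intro Min_le) auto
    then show "\<sigma> \<le> \<rho> i \<and> \<sigma> \<le> \<gamma> - \<rho> i" by simp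
  qed
  define D where "D = max 1 T"
  define K where "K = (\<Sum>j<m. c j * D powr \<gamma>)"
  have "N (h t u s) \<le> K * min (t - u) (u - s) powr \<sigma>"
    if x: "(t, u, s) \<in> simplex3 T" and su: "s < u" and ut: "u < t" for t u s
  proof -
    have gap: "0 < t - u" "t - u \<le> D" "0 < u - s" "u - s \<le> D"
      using x su ut by (auto simp: simplex3_def D_def)
    have "N (hs i t u s) \<le> c i * D powr \<gamma> * min (t - u) (u - s) powr \<sigma>" if i: "i < m" for i
    proof -
      have "N (hs i t u s) / ((t - u) powr \<rho> i * (u - s) powr (\<gamma> - \<rho> i)) \<le> c i"
        using c(2)[OF i, of t u s] x su ut by simp
      then have "N (hs i t u s) \<le> c i * ((t - u) powr \<rho> i * (u - s) powr (\<gamma> - \<rho> i))"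
        using su ut by (simp add: pos_divide_le_eq)
      also have "(t - u) powr \<rho> i * (u - s) powr (\<gamma> - \<rho> i)
          \<le> D powr (\<rho> i + (\<gamma> - \<rho> i)) * min (t - u) (u - s) powr \<sigma>"
        using gap \<sigma>(1) \<sigma>(2)[OF i] by (intro powr_product_le_powr_min) (auto simp: D_def)
      finally show ?thesis using c(1)[OF i] by (simp add: mult.assoc mult_left_mono)
    qed
    then have "(\<Sum>i<m. N (hs i t u s)) \<le> K * min (t - u) (u - s) powr \<sigma>"
      unfolding K_def sum_distrib_right by (intro sum_mono) simp
    moreover have "N (h t u s) \<le> (\<Sum>i<m. N (hs i t u s))"
      unfolding h by (rule norm_sum_le[THEN conjunct2]) (use j in \<open>auto intro: cincr3_mem\<close>)
    ultimately show ?thesis by linarith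
  qed
  moreover have "K \<ge> 0" unfolding K_def using c(1) by (intro sum_nonneg) simp
  ultimately show ?thesis using \<sigma>(1) by blast
qed

end

context c0_semigroup
begin

lemma cocycle_identity:
  assumes "H \<in> cocycles T V N S \<gamma>" "0 \<le> s" "s \<le> u" "u \<le> v" "v \<le> t" "t \<le> T"
  shows "H t u s - H t v s + H t v u - S (t - v) (H v u s) = 0"
proof -
  have "delta3 T S H t v u s = 0"
    using assms(1) by (simp add: cocycles_def fun_eq_iff)
  then show ?thesis using assms(2-) by (simp add: delta3_eq simplex4_def)
qed

text \<open>On the diagonal \<open>H\<close> is the limit of values at points whose gaps shrink to \<open>0\<close>; the
  cocycle identity carries the vanishing over to the two faces.\<close>

lemma cocycle_degenerate:
  assumes H: "H \<in> cocycles T V N S \<gamma>" and "0 < \<gamma>" and "T > 0"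
    and "0 \<le> s" "s \<le> t" "t \<le> T"
  shows "H t t s = 0" "H t s s = 0"
proof -
  have H3: "H \<in> cincr3 T V N" "norm3 T V N \<gamma> H < \<infinity>"
    using H by (auto simp: cocycles_def)
  note V = cincr3_mem[OF H3(1)]
  obtain K \<rho> where K: "K \<ge> 0" and \<rho>: "\<rho> > 0"
    and decay: "\<And>t u s. (t, u, s) \<in> simplex3 T \<Longrightarrow> s < u \<Longrightarrow> u < t \<Longrightarrow>
        N (H t u s) \<le> K * min (t - u) (u - s) powr \<rho>"
    using norm3_finite_imp_decay[OF H3(2) \<open>0 < \<gamma>\<close>] by blast
  have diag: "H u u u = 0" if u: "0 \<le> u" "u \<le> T" for u
  proof (rule ccontr)
    assume "H u u u \<noteq> 0"
    define e where "e = N (H u u u) / 2"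
    have "e > 0" using \<open>H u u u \<noteq> 0\<close> V norm_nonneg norm_eq_0_iff
      unfolding e_def by (smt (verit) half_gt_zero)
    obtain d where d: "d > 0"
      "\<And>t v s. (t, v, s) \<in> simplex3 T \<Longrightarrow> dist (t, v, s) (u, u, u) < d \<Longrightarrow> N (H t v s - H u u u) < e"
    proof -
      have "continuous_map (top_of_set (simplex3 T)) (ntopology V N) (\<lambda>(t, u, s). H t u s)"
        using H3 by (simp add: cincr3_def)
      moreover have "(u, u, u) \<in> simplex3 T" using u by (simp add: simplex3_def)
      ultimately show ?thesis
        using \<open>e > 0\<close> that unfolding continuous_map_iff by fastforce
    qed
    \<comment> \<open>A gap below which the decay estimate drops under \<open>e\<close>, followed by three equally
      spaced times near \<open>u\<close> that stay inside \<open>[0, T]\<close>.\<close>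
    define x where "x = min (min (d / 5) (T / 5)) ((e / (2 * (K + 1))) powr (1 / \<rho>))"
    have x: "x < d / 4" "x < T / 4" "0 < x"
      using d \<open>T > 0\<close> \<open>e > 0\<close> K by (auto simp: x_def)
    have "x powr \<rho> \<le> ((e / (2 * (K + 1))) powr (1 / \<rho>)) powr \<rho>"
      using x \<rho> by (intro powr_mono2) (auto simp: x_def)
    also have "\<dots> = e / (2 * (K + 1))"
      using \<rho> K \<open>e > 0\<close> by (simp add: powr_powr)
    finally have "(K + 1) * x powr \<rho> \<le> e / 2"
      using K by (auto simp: field_simps)
    moreover have "0 < x powr \<rho>" using x by simp
    ultimately have Kx: "K * x powr \<rho> < e"
      using \<open>e > 0\<close> distrib_right[of K 1 "x powr \<rho>"] by linarith
    define a where "a = (if u \<le> T / 2 then u else u - 2 * x)"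
    have a: "0 \<le> a" "a + 2 * x \<le> T" "\<bar>a - u\<bar> \<le> 2 * x" "\<bar>a + x - u\<bar> \<le> x" "\<bar>a + 2 * x - u\<bar> \<le> 2 * x"
      using x u by (auto simp: a_def)
    have mem: "(a + 2 * x, a + x, a) \<in> simplex3 T" using a x by (simp add: simplex3_def)
    have "dist (a + 2 * x, a + x, a) (u, u, u) \<le> 3 * x"
    proof -
      have "(a + 2 * x - u)\<^sup>2 + ((a + x - u)\<^sup>2 + (a - u)\<^sup>2) \<le> (2 * x)\<^sup>2 + (x\<^sup>2 + (2 * x)\<^sup>2)"
        using a x by (intro add_mono abs_le_square_iff[THEN iffD1]) auto
      also have "\<dots> = (3 * x)\<^sup>2" by (simp add: power2_eq_square)
      finally show ?thesis using x
        by (simp add: dist_Pair_Pair dist_real_def real_le_lsqrt)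
    qed
    then have "N (H (a + 2 * x) (a + x) a - H u u u) < e"
      using d(2)[OF mem] x by simp
    moreover have "N (H (a + 2 * x) (a + x) a) < e"
      using decay[OF mem] x Kx by simp
    moreover have "N (H u u u) \<le> N (H u u u - H (a + 2 * x) (a + x) a) + N (H (a + 2 * x) (a + x) a)"
      using norm_add_le[of "H u u u - H (a + 2 * x) (a + x) a" "H (a + 2 * x) (a + x) a"] V by simp
    ultimately show False
      using norm_diff_commute[OF V V] by (simp add: e_def)
  qed
  show "H t t s = 0"
    using cocycle_identity[OF H, of s t t t] assms S_id[OF V] diag by simp
  show "H t s s = 0"
    using cocycle_identity[OF H, of s s s t] assms diag by simp
qed

lemma cocycle_decay:
  assumes H: "H \<in> cocycles T V N S \<gamma>" and "0 < \<gamma>" and "T > 0"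
  shows "\<exists>K\<ge>0. \<exists>\<rho>>0. \<forall>t u s. (t, u, s) \<in> simplex3 T \<longrightarrow>
           N (H t u s) \<le> K * min (t - u) (u - s) powr \<rho>"
proof -
  have "norm3 T V N \<gamma> H < \<infinity>" using H by (simp add: cocycles_def)
  from norm3_finite_imp_decay[OF this \<open>0 < \<gamma>\<close>] obtain K \<rho> where K: "K \<ge> 0" "\<rho> > 0"
    and decay: "\<And>t u s. (t, u, s) \<in> simplex3 T \<Longrightarrow> s < u \<Longrightarrow> u < t \<Longrightarrow>
        N (H t u s) \<le> K * min (t - u) (u - s) powr \<rho>" by blast
  have "N (H t u s) \<le> K * min (t - u) (u - s) powr \<rho>" if x: "(t, u, s) \<in> simplex3 T" for t u s
  proof (cases "s < u \<and> u < t")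
    case True
    then show ?thesis using decay x by simp
  next
    case False
    then have "H t u s = 0"
      using cocycle_degenerate[OF assms, of s t] x by (auto simp: simplex3_def)
    then show ?thesis using K by simp
  qed
  then show ?thesis using K by blast
qed

end

section \<open>Dyadic points\<close>

lemma dyadic_pt_0 [simp]: "dyadic_pt T n 0 = 0"
  by (simp add: dyadic_pt_def)

lemma dyadic_pt_Suc_double: "dyadic_pt T (Suc n) (2 * k) = dyadic_pt T n k"
  by (simp add: dyadic_pt_def)

lemma dyadic_pt_Suc: "dyadic_pt T n (Suc k) = dyadic_pt T n k + T / 2 ^ n"
  by (simp add: dyadic_pt_def field_simps)

lemma dyadic_pt_mono: "T > 0 \<Longrightarrow> i \<le> j \<Longrightarrow> dyadic_pt T n i \<le> dyadic_pt T n j"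
  by (simp add: dyadic_pt_def divide_right_mono)

lemma dyadic_pt_le: "T > 0 \<Longrightarrow> k \<le> 2 ^ n \<Longrightarrow> dyadic_pt T n k \<le> T"
  by (simp add: dyadic_pt_def field_simps)

lemma dyadic_pt_nonneg: "T > 0 \<Longrightarrow> 0 \<le> dyadic_pt T n k"
  by (simp add: dyadic_pt_def)

lemma dyadic_pt_in_dyadics: "k \<le> 2 ^ n \<Longrightarrow> dyadic_pt T n k \<in> dyadics T"
  by (auto simp: dyadics_def)

lemma dyadics_subset: "T > 0 \<Longrightarrow> dyadics T \<subseteq> {0..T}"
  by (auto simp: dyadics_def dyadic_pt_nonneg dyadic_pt_le)

lemma zero_in_dyadics: "0 \<in> dyadics T"
  using dyadic_pt_in_dyadics[of 0 0 T] by simp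

lemma dyadic_pt_refine: "dyadic_pt T (n + m) (2 ^ m * k) = dyadic_pt T n k"
  by (simp add: dyadic_pt_def power_add)

lemma dyadics_eventually_level:
  assumes "s \<in> dyadics T"
  shows "\<exists>n. \<forall>m\<ge>n. \<exists>i\<le>2 ^ m. s = dyadic_pt T m i"
proof -
  obtain n k where nk: "s = dyadic_pt T n k" "k \<le> 2 ^ n"
    using assms by (auto simp: dyadics_def)
  have "\<exists>i\<le>2 ^ m. s = dyadic_pt T m i" if "m \<ge> n" for m
  proof (intro exI conjI)
    have "2 ^ (m - n) * k \<le> 2 ^ (m - n) * 2 ^ n" using nk by (intro mult_left_mono) auto
    then show "2 ^ (m - n) * k \<le> 2 ^ m" using that by (simp flip: power_add)
    show "s = dyadic_pt T m (2 ^ (m - n) * k)"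
      using dyadic_pt_refine[of T n "m - n" k] nk that by simp
  qed
  then show ?thesis by blast
qed

lemma dyadics_common_level:
  assumes "s \<in> dyadics T" "t \<in> dyadics T"
  shows "\<exists>m\<ge>k. \<exists>i\<le>2 ^ m. \<exists>j\<le>2 ^ m. s = dyadic_pt T m i \<and> t = dyadic_pt T m j"
proof -
  obtain n1 n2 where "\<forall>m\<ge>n1. \<exists>i\<le>2 ^ m. s = dyadic_pt T m i" "\<forall>m\<ge>n2. \<exists>j\<le>2 ^ m. t = dyadic_pt T m j"
    using assms dyadics_eventually_level by metis
  then show ?thesis
    by (intro exI[of _ "max k (max n1 n2)"]) (meson max.cobounded1 max.cobounded2 order_trans)
qed

text \<open>Rounding down to the grid of level \<open>n\<close> is monotone, so ordered pairs of times are
  approximated by ordered pairs of dyadic points.\<close>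

definition dyadic_floor :: "real \<Rightarrow> nat \<Rightarrow> real \<Rightarrow> real" where
  "dyadic_floor T n t = dyadic_pt T n (nat \<lfloor>t * 2 ^ n / T\<rfloor>)"

lemma dyadic_floor:
  assumes "T > 0" "0 \<le> t" "t \<le> T"
  shows "dyadic_floor T n t \<in> dyadics T" "\<bar>dyadic_floor T n t - t\<bar> \<le> T / 2 ^ n"
proof -
  let ?x = "t * 2 ^ n / T"
  have x: "0 \<le> ?x" "?x \<le> 2 ^ n" using assms by (auto simp: field_simps)
  have "nat \<lfloor>?x\<rfloor> \<le> 2 ^ n"
    using floor_mono[OF x(2)] by (simp add: nat_le_iff)
  then show "dyadic_floor T n t \<in> dyadics T"
    unfolding dyadic_floor_def by (rule dyadic_pt_in_dyadics)
  have "\<bar>real (nat \<lfloor>?x\<rfloor>) - ?x\<bar> \<le> 1" using x by linarith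
  moreover have "dyadic_floor T n t - t = (real (nat \<lfloor>?x\<rfloor>) - ?x) * (T / 2 ^ n)"
    using assms by (simp add: dyadic_floor_def dyadic_pt_def field_simps)
  ultimately show "\<bar>dyadic_floor T n t - t\<bar> \<le> T / 2 ^ n"
    using assms mult_right_mono[of "\<bar>real (nat \<lfloor>?x\<rfloor>) - ?x\<bar>" 1 "T / 2 ^ n"] by (simp add: abs_mult)
qed

lemma dyadic_floor_mono:
  assumes "T > 0" "s \<le> t"
  shows "dyadic_floor T n s \<le> dyadic_floor T n t"
  unfolding dyadic_floor_def using assms
  by (intro dyadic_pt_mono nat_mono floor_mono divide_right_mono mult_right_mono) auto

lemma mesh_powr: "(T::real) > 0 \<Longrightarrow> (T / 2 ^ n) powr a = T powr a * ((1 / 2) powr a) ^ n"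
proof (induction n)
  case (Suc n)
  have "T / 2 ^ Suc n = (T / 2 ^ n) * (1 / 2)" by simp
  then have "(T / 2 ^ Suc n) powr a = (T / 2 ^ n) powr a * (1 / 2) powr a"
    using Suc.prems by (simp only: powr_mult)
  then show ?case using Suc by simp
qed simp

lemma summable_mesh_powr: "(T::real) > 0 \<Longrightarrow> a > 0 \<Longrightarrow> summable (\<lambda>n. (T / 2 ^ n) powr a)"
  using powr_less_mono2[of a "1 / 2" 1]
  unfolding mesh_powr by (intro summable_mult summable_geometric) auto

lemma mesh_tendsto_0: "(\<lambda>n. T / 2 ^ n) \<longlonglongrightarrow> (0::real)"
  using tendsto_mult[OF tendsto_const[of T] LIMSEQ_power_zero[of "1 / 2 :: real"]]
  by (simp add: power_divide)

lemma summable_if_contracting: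
  fixes r b :: "nat \<Rightarrow> real"
  assumes r: "\<And>n. 0 \<le> r n" and b: "summable b" "\<And>n. 0 \<le> b n"
    and \<theta>: "0 \<le> \<theta>" "\<theta> < 1" and step: "\<And>n. n \<ge> n0 \<Longrightarrow> r (Suc n) \<le> \<theta> * r n + b n"
  shows "summable r"
proof -
  \<comment> \<open>The fixed point of the recursion that the partial sums satisfy.\<close>
  define c where "c = (r n0 + suminf b) / (1 - \<theta>)"
  have c: "r n0 + \<theta> * c + suminf b = c"
    using \<theta> by (simp add: c_def field_simps)
  have "(\<Sum>k<m. r (k + n0)) \<le> c" for m
  proof (induction m)
    case 0
    show ?case using r[of n0] suminf_nonneg[OF b] \<theta> by (simp add: c_def)
  next
    case (Suc m)
    have "(\<Sum>k<Suc m. r (k + n0)) = r n0 + (\<Sum>k<m. r (Suc (k + n0)))"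
      by (subst sum.lessThan_Suc_shift) simp
    also have "\<dots> \<le> r n0 + (\<Sum>k<m. \<theta> * r (k + n0) + b (k + n0))"
      by (intro add_left_mono sum_mono step) simp
    also have "\<dots> = r n0 + \<theta> * (\<Sum>k<m. r (k + n0)) + (\<Sum>k<m. b (k + n0))"
      by (simp add: sum.distrib sum_distrib_left)
    also have "(\<Sum>k<m. b (k + n0)) = (\<Sum>k\<in>{n0..<n0+m}. b k)"
      by (rule sum.reindex_bij_witness[of _ "\<lambda>k. k - n0" "\<lambda>k. k + n0"]) auto
    also have "\<dots> \<le> suminf b"
      using b by (intro sum_le_suminf) auto
    also have "\<theta> * (\<Sum>k<m. r (k + n0)) \<le> \<theta> * c"
      using Suc \<theta> by (intro mult_left_mono) auto
    finally show ?case using c by simp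
  qed
  then have "summable (\<lambda>k. r (k + n0))"
    using r by (intro summableI_nonneg_bounded) auto
  then show ?thesis by (simp add: summable_iff_shift)
qed

section \<open>The dyadic residual\<close>

locale dyadic_recursion = c0_semigroup V N S
  for V :: "'a::real_vector set" and N :: "'a \<Rightarrow> real" and S :: "real \<Rightarrow> 'a \<Rightarrow> 'a" +
  fixes T \<gamma> :: real and sp :: "'a splitting_rule"
    and D :: "(real \<Rightarrow> real \<Rightarrow> real \<Rightarrow> 'a) set" and H :: "real \<Rightarrow> real \<Rightarrow> real \<Rightarrow> 'a"
  assumes T_pos: "T > 0" and \<gamma>_pos: "0 < \<gamma>" and \<gamma>_le: "\<gamma> \<le> 1"
    and admissible: "admissible_domain T V N S \<gamma> sp D"
    and H_in_D: "H \<in> D"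
begin

abbreviation "p \<equiv> dyadic_pt T"
abbreviation "I \<equiv> dyadic_path T S sp H"
abbreviation "R \<equiv> residual T S sp H"

lemma H_cocycle: "H \<in> cocycles T V N S \<gamma>"
  using admissible H_in_D by (auto simp: admissible_domain_def)

lemma H_mem [simp]: "H t u s \<in> V"
  using H_cocycle cincr3_mem unfolding cocycles_def by blast

lemma base_mem [simp]: "base_incr H t s \<in> V"
  by (simp add: base_incr_def)

lemma dyadic_interval_pt: "k < 2 ^ n \<Longrightarrow> dyadic_interval T (p n k) (p n (Suc k))"
  by (auto simp: dyadic_interval_def)

lemma pt_midpoint: "(p n k + p n (Suc k)) / 2 = p (Suc n) (Suc (2 * k))"
  by (simp add: dyadic_pt_def field_simps)

lemma
  assumes "dyadic_interval T a c"
  shows child_mem: "fst (child_residuals T S sp H a c) \<in> V" "snd (child_residuals T S sp H a c) \<in> V"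
    and child_identity: "residual T S sp H c a =
      fst (child_residuals T S sp H a c)
      + S (c - (a + c) / 2) (snd (child_residuals T S sp H a c)) + H c ((a + c) / 2) a"
  using admissible H_in_D assms unfolding admissible_domain_def Let_def by blast+

lemma path_pt_mem: "k \<le> 2 ^ n \<Longrightarrow> I (p n k) \<in> V"
proof (induction n arbitrary: k)
  case 0
  then have "k = 0 \<or> k = 1" by auto
  then show ?case
  proof
    assume "k = 1"
    then have "p 0 k = T" by (simp add: dyadic_pt_def)
    then show ?thesis using dyadic_path_rec(2)[OF T_pos, of S sp H] by simp
  qed (use dyadic_path_rec(1)[OF T_pos, of S sp H] in simp)
next
  case (Suc n)
  show ?case
  proof (cases "even k")
    case True
    then obtain i where "k = 2 * i" by (auto elim: evenE)
    then show ?thesis using Suc by (simp add: dyadic_pt_Suc_double)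
  next
    case False
    then obtain i where i: "k = Suc (2 * i)" by (auto elim: oddE)
    then have "i < 2 ^ n" using Suc.prems by simp
    note int = dyadic_interval_pt[OF this]
    have "p n i \<le> p (Suc n) k"
      unfolding i dyadic_pt_Suc dyadic_pt_Suc_double using T_pos by simp
    then show ?thesis
      using dyadic_path_rec(3)[OF T_pos int pt_midpoint[symmetric], of S sp H] Suc.IH[of i]
        \<open>i < 2 ^ n\<close> child_mem[OF int] i by simp
  qed
qed

lemma path_mem: "t \<in> dyadics T \<Longrightarrow> I t \<in> V"
  unfolding dyadics_def using path_pt_mem by auto

lemma residual_mem: "t \<in> dyadics T \<Longrightarrow> s \<in> dyadics T \<Longrightarrow> s \<le> t \<Longrightarrow> R t s \<in> V"
  unfolding residual_def by (simp add: path_mem)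

lemma residual_diag: "t \<in> dyadics T \<Longrightarrow> R t t = 0"
  using cocycle_degenerate(1)[OF H_cocycle \<gamma>_pos T_pos, of 0 t] dyadics_subset[OF T_pos]
  by (auto simp: residual_def base_incr_def S_id path_mem)

text \<open>Both \<open>base_incr H\<close> (by the cocycle identity at \<open>s = 0\<close>) and the path contribute to
  the coboundary of the residual; the path's share vanishes by the semigroup law.\<close>

lemma residual_coboundary:
  assumes "s \<in> dyadics T" "u \<in> dyadics T" "t \<in> dyadics T" "s \<le> u" "u \<le> t"
  shows "R t s = R t u + S (t - u) (R u s) + H t u s"
proof -
  have bd: "0 \<le> s" "t \<le> T" using dyadics_subset[OF T_pos] assms by auto
  have base: "base_incr H t s = base_incr H t u + S (t - u) (base_incr H u s) + H t u s"
    using cocycle_identity[OF H_cocycle, of 0 s u t] bd assms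
    by (simp add: base_incr_def S_uminus algebra_simps)
  have "S (t - u) (R u s) = S (t - u) (base_incr H u s) - S (t - u) (I u) + S (t - s) (I s)"
    using assms path_mem by (simp add: residual_def S_add S_diff S_compose)
  then show ?thesis
    using base by (simp add: residual_def algebra_simps)
qed

text \<open>The child residuals prescribed by the rule are the residuals of the constructed path:
  the lower one by definition of the midpoint value, the upper one because both satisfy the
  same coboundary equation.\<close>

lemma
  assumes "k < 2 ^ n"
  shows snd_child: "snd (child_residuals T S sp H (p n k) (p n (Suc k))) = R (p (Suc n) (Suc (2 * k))) (p n k)"
    and fst_child: "fst (child_residuals T S sp H (p n k) (p n (Suc k))) = R (p n (Suc k)) (p (Suc n) (Suc (2 * k)))"
proof -
  let ?a = "p n k" and ?b = "p (Suc n) (Suc (2 * k))" and ?c = "p n (Suc k)"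
  note int = dyadic_interval_pt[OF assms]
  show snd: "snd (child_residuals T S sp H ?a ?c) = R ?b ?a"
    using dyadic_path_rec(3)[OF T_pos int pt_midpoint[symmetric], of S sp H]
    by (simp add: residual_def)
  have "?a \<in> dyadics T" "?b \<in> dyadics T" "?c \<in> dyadics T"
    using assms by (auto intro!: dyadic_pt_in_dyadics)
  moreover have "?a \<le> ?b" "?b \<le> ?c"
    using pt_midpoint[of n k] dyadic_pt_mono[OF T_pos, of k "Suc k" n] by auto
  ultimately have "R ?c ?a = R ?c ?b + S (?c - ?b) (R ?b ?a) + H ?c ?b ?a"
    by (intro residual_coboundary)
  then show "fst (child_residuals T S sp H ?a ?c) = R ?c ?b"
    using child_identity[OF int] snd by (simp add: pt_midpoint)
qed

text \<open>In both regimes the admissibility bound is a strict contraction on fine levels: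
  \<open>2 powr (- \<gamma>) < 1\<close>, and for \<open>\<gamma> = 1\<close> the factor \<open>1 / 2 + C * L powr \<eta>\<close> tends to
  \<open>1 / 2\<close> with \<open>L\<close>.\<close>

lemma child_contraction:
  "\<exists>\<theta> C n0. 0 \<le> \<theta> \<and> \<theta> < 1 \<and> 0 \<le> C \<and> (\<forall>n\<ge>n0. \<forall>k<2 ^ n.
     max (N (fst (child_residuals T S sp H (p n k) (p n (Suc k)))))
         (N (snd (child_residuals T S sp H (p n k) (p n (Suc k)))))
     \<le> \<theta> * N (R (p n (Suc k)) (p n k)) + C * (T / 2 ^ n) powr \<gamma>)"
proof -
  have "\<exists>f \<theta> n0. child_bound T V N S \<gamma> sp D f \<and> 0 \<le> \<theta> \<and> \<theta> < 1 \<and> (\<forall>n\<ge>n0. f (T / 2 ^ n) \<le> \<theta>)"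
  proof (cases "\<gamma> < 1")
    case True
    then obtain \<theta> where "\<theta> < 2 powr (- \<gamma>)" "child_bound T V N S \<gamma> sp D (\<lambda>L. \<theta>)"
      using admissible \<gamma>_pos unfolding admissible_domain_def by blast
    moreover have "2 powr (- \<gamma>) < (1::real)"
      using powr_less_mono[of "- \<gamma>" 0 2] \<gamma>_pos by simp
    ultimately have "child_bound T V N S \<gamma> sp D (\<lambda>L. \<theta>) \<and> 0 \<le> max 0 \<theta> \<and> max 0 \<theta> < 1 \<and>
        (\<forall>n\<ge>0. \<theta> \<le> max 0 \<theta>)" by simp
    then show ?thesis by blast
  next
    case False
    then have "\<gamma> = 1" using \<gamma>_le by simp
    then obtain C \<eta> where C: "C > 0" "\<eta> > 0"
      "child_bound T V N S \<gamma> sp D (\<lambda>L. 1 / 2 + C * L powr \<eta>)"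
      using admissible unfolding admissible_domain_def by blast
    have "(\<lambda>n. C * (T / 2 ^ n) powr \<eta>) \<longlonglongrightarrow> C * 0"
      using summable_LIMSEQ_zero[OF summable_mesh_powr[OF T_pos C(2)]] by (intro tendsto_intros)
    then have "eventually (\<lambda>n. C * (T / 2 ^ n) powr \<eta> < 1 / 4) sequentially"
      by (intro order_tendstoD) auto
    then obtain n0 where "\<forall>n\<ge>n0. C * (T / 2 ^ n) powr \<eta> < 1 / 4"
      by (auto simp: eventually_sequentially)
    then have "\<forall>n\<ge>n0. 1 / 2 + C * (T / 2 ^ n) powr \<eta> \<le> 3 / 4" by fastforce
    then show ?thesis
      using C(3) by (intro exI[of _ "\<lambda>L. 1 / 2 + C * L powr \<eta>"] exI[of _ "3 / 4"] exI[of _ n0] conjI) simp_all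
  qed
  then obtain f \<theta> n0 where f: "child_bound T V N S \<gamma> sp D f" and \<theta>: "0 \<le> \<theta>" "\<theta> < 1"
    and f\<theta>: "\<And>n. n \<ge> n0 \<Longrightarrow> f (T / 2 ^ n) \<le> \<theta>" by blast
  obtain C where C: "\<And>a c. dyadic_interval T a c \<Longrightarrow>
      max (N (fst (child_residuals T S sp H a c))) (N (snd (child_residuals T S sp H a c)))
      \<le> f (c - a) * N (R c a) + C * (c - a) powr \<gamma>"
    using f H_in_D unfolding child_bound_def by blast
  have "max (N (fst (child_residuals T S sp H (p n k) (p n (Suc k)))))
         (N (snd (child_residuals T S sp H (p n k) (p n (Suc k)))))
     \<le> \<theta> * N (R (p n (Suc k)) (p n k)) + \<bar>C\<bar> * (T / 2 ^ n) powr \<gamma>"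
    if n: "n \<ge> n0" and k: "k < 2 ^ n" for n k
  proof -
    have "R (p n (Suc k)) (p n k) \<in> V"
      using k by (intro residual_mem dyadic_pt_in_dyadics dyadic_pt_mono T_pos) auto
    then have "f (T / 2 ^ n) * N (R (p n (Suc k)) (p n k)) \<le> \<theta> * N (R (p n (Suc k)) (p n k))"
      using f\<theta>[OF n] norm_nonneg by (intro mult_right_mono)
    moreover have "C * (T / 2 ^ n) powr \<gamma> \<le> \<bar>C\<bar> * (T / 2 ^ n) powr \<gamma>"
      by (intro mult_right_mono) auto
    ultimately have le: "f (T / 2 ^ n) * N (R (p n (Suc k)) (p n k)) + C * (T / 2 ^ n) powr \<gamma>
        \<le> \<theta> * N (R (p n (Suc k)) (p n k)) + \<bar>C\<bar> * (T / 2 ^ n) powr \<gamma>"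
      by (rule add_mono)
    have gap: "p n (Suc k) - p n k = T / 2 ^ n" by (simp add: dyadic_pt_Suc)
    show ?thesis
      using C[OF dyadic_interval_pt[OF k], unfolded gap] le by (rule order_trans)
  qed
  then show ?thesis using \<theta> by (intro exI[of _ \<theta>] exI[of _ "\<bar>C\<bar>"] exI[of _ n0]) auto
qed

lemma level_residuals_summable:
  "\<exists>r. summable r \<and> (\<forall>n. 0 \<le> r n) \<and> (\<forall>n. \<forall>k<2 ^ n. N (R (p n (Suc k)) (p n k)) \<le> r n)"
proof -
  define r where "r n = Max ((\<lambda>k. N (R (p n (Suc k)) (p n k))) ` {..<2 ^ n})" for n :: nat
  have r: "N (R (p n (Suc k)) (p n k)) \<le> r n" if "k < 2 ^ n" for n k
    unfolding r_def using that by (intro Max_ge finite_imageI finite_lessThan imageI) simp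
  have mem: "R (p n (Suc k)) (p n k) \<in> V" if "k < 2 ^ n" for n k
    using that by (intro residual_mem dyadic_pt_in_dyadics dyadic_pt_mono T_pos) auto
  have r0: "0 \<le> r n" for n
    using r[of 0 n] norm_nonneg[OF mem[of 0 n]] by simp
  obtain \<theta> C n0 where \<theta>: "0 \<le> \<theta>" "\<theta> < 1" and C: "0 \<le> C"
    and child: "\<And>n k. n \<ge> n0 \<Longrightarrow> k < 2 ^ n \<Longrightarrow>
     max (N (fst (child_residuals T S sp H (p n k) (p n (Suc k)))))
         (N (snd (child_residuals T S sp H (p n k) (p n (Suc k)))))
     \<le> \<theta> * N (R (p n (Suc k)) (p n k)) + C * (T / 2 ^ n) powr \<gamma>"
    using child_contraction by blast
  have "r (Suc n) \<le> \<theta> * r n + C * (T / 2 ^ n) powr \<gamma>" if n: "n \<ge> n0" for n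
  proof -
    have "N (R (p (Suc n) (Suc k)) (p (Suc n) k)) \<le> \<theta> * r n + C * (T / 2 ^ n) powr \<gamma>"
      if k: "k < 2 ^ Suc n" for k
    proof -
      define i where "i = k div 2"
      have i: "i < 2 ^ n" using k unfolding i_def by simp
      have "k = 2 * i \<or> k = Suc (2 * i)" unfolding i_def by presburger
      then have "N (R (p (Suc n) (Suc k)) (p (Suc n) k)) \<le> \<theta> * N (R (p n (Suc i)) (p n i)) + C * (T / 2 ^ n) powr \<gamma>"
      proof
        assume "k = 2 * i"
        then show ?thesis
          using child[OF n i] snd_child[OF i] by (simp add: dyadic_pt_Suc_double)
      next
        assume k: "k = Suc (2 * i)"
        then have "p (Suc n) (Suc k) = p n (Suc i)"
          using dyadic_pt_Suc_double[of T n "Suc i"] by simp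
        then show ?thesis
          using child[OF n i] fst_child[OF i] k by simp
      qed
      also have "\<dots> \<le> \<theta> * r n + C * (T / 2 ^ n) powr \<gamma>"
        using r[OF i] \<theta> by (intro add_right_mono mult_left_mono)
      finally show ?thesis .
    qed
    note bound = this
    show ?thesis
      unfolding r_def[of "Suc n"]
    proof (rule Max.boundedI)
      have "(0::nat) \<in> {..<2 ^ Suc n}" by simp
      then show "(\<lambda>k. N (R (p (Suc n) (Suc k)) (p (Suc n) k))) ` {..<2 ^ Suc n} \<noteq> {}"
        by blast
      show "a \<le> \<theta> * r n + C * (T / 2 ^ n) powr \<gamma>"
        if "a \<in> (\<lambda>k. N (R (p (Suc n) (Suc k)) (p (Suc n) k))) ` {..<2 ^ Suc n}" for a
        using that bound by (elim imageE) (simp only: lessThan_iff)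
    qed (intro finite_imageI finite_lessThan)
  qed
  moreover have "summable (\<lambda>n. C * (T / 2 ^ n) powr \<gamma>)"
    by (intro summable_mult summable_mesh_powr T_pos \<gamma>_pos)
  moreover have "0 \<le> C * (T / 2 ^ n) powr \<gamma>" for n
    using C by simp
  ultimately have "summable r"
    using summable_if_contracting[of r "\<lambda>n. C * (T / 2 ^ n) powr \<gamma>" \<theta> n0] r0 \<theta> by blast
  then show ?thesis using r r0 by blast
qed

text \<open>Two applications of the coboundary equation split off the outer pieces of \<open>[s, t]\<close>; the
  semigroup law then leaves exactly one factor of \<open>S\<close> in front of each term.\<close>

lemma action_residual_refine:
  assumes "s \<in> dyadics T" "s' \<in> dyadics T" "t' \<in> dyadics T" "t \<in> dyadics T"
    and "s \<le> s'" "s' \<le> t'" "t' \<le> t" "0 \<le> \<tau>"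
  shows "S \<tau> (R t s) = S (\<tau> + (t - t')) (R t' s') + S \<tau> (R t t') + S (\<tau> + (t - s')) (R s' s)
    + S (\<tau> + (t - t')) (H t' s' s) + S \<tau> (H t t' s)"
proof -
  have mem: "R t t' \<in> V" "R t' s' \<in> V" "R s' s \<in> V" "R t' s \<in> V"
    using assms by (auto intro: residual_mem)
  have "R t s = R t t' + S (t - t') (R t' s) + H t t' s"
    using assms by (intro residual_coboundary) auto
  also have "R t' s = R t' s' + S (t' - s') (R s' s) + H t' s' s"
    using assms by (intro residual_coboundary) auto
  also have "S (t - t') \<dots> = S (t - t') (R t' s') + S (t - s') (R s' s) + S (t - t') (H t' s' s)"
    using assms mem by (simp add: S_add S_compose)
  finally show ?thesis
    using assms mem by (simp add: S_add S_compose algebra_simps)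
qed

lemma action_elementary_residual:
  assumes r: "\<And>k. k < 2 ^ n \<Longrightarrow> N (R (p n (Suc k)) (p n k)) \<le> r"
    and M: "M \<ge> 0" "\<And>t x. t \<in> {0..T} \<Longrightarrow> x \<in> V \<Longrightarrow> N (S t x) \<le> M * N x"
    and k: "k < 2 ^ n" and "\<tau> \<in> {0..T}"
  shows "N (S \<tau> (R (p n (Suc k)) (p n k))) \<le> M * r"
proof -
  have "R (p n (Suc k)) (p n k) \<in> V"
    using k by (intro residual_mem dyadic_pt_in_dyadics dyadic_pt_mono T_pos) auto
  then show ?thesis
    using M(2)[OF \<open>\<tau> \<in> {0..T}\<close>] mult_left_mono[OF r[OF k] M(1)] order_trans by blast
qed

text \<open>Chaining: passing from level \<open>n\<close> to level \<open>n + 1\<close>, the end points are rounded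
  inwards to level \<open>n\<close>, which costs at most two elementary residuals and two cocycle errors.
  The extra factor \<open>S \<tau>\<close> is carried along so that the semigroup law merges successive factors
  into a single one, bounded by \<open>M\<close>; bounding them one at a time would produce powers of
  \<open>M\<close>.\<close>

lemma residual_chain:
  assumes r: "\<And>n k. k < 2 ^ n \<Longrightarrow> N (R (p n (Suc k)) (p n k)) \<le> r n"
    and w: "\<And>n t u s. (t, u, s) \<in> simplex3 T \<Longrightarrow> min (t - u) (u - s) \<le> T / 2 ^ n \<Longrightarrow> N (H t u s) \<le> w n"
    and M: "M \<ge> 0" "\<And>t x. t \<in> {0..T} \<Longrightarrow> x \<in> V \<Longrightarrow> N (S t x) \<le> M * N x"
    and "n \<ge> m"
  shows "i \<le> j \<Longrightarrow> j \<le> 2 ^ n \<Longrightarrow> p n j - p n i \<le> T / 2 ^ m \<Longrightarrow> 0 \<le> \<tau> \<Longrightarrow> \<tau> + (p n j - p n i) \<le> T \<Longrightarrow>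
    N (S \<tau> (R (p n j) (p n i))) \<le> M * (\<Sum>l=m..n. 2 * (r l + w l))"
  using \<open>n \<ge> m\<close>
proof (induction n arbitrary: i j \<tau> rule: dec_induct)
  have r0: "0 \<le> r n" for n
  proof -
    have "R (p n (Suc 0)) (p n 0) \<in> V"
      by (intro residual_mem dyadic_pt_in_dyadics dyadic_pt_mono T_pos) auto
    from norm_nonneg[OF this] show ?thesis using r[of 0 n] by simp
  qed
  have w0: "0 \<le> w n" for n
  proof -
    have "N (H 0 0 0) \<le> w n" using T_pos by (intro w) (auto simp: simplex3_def)
    then show ?thesis using norm_nonneg[OF H_mem[of 0 0 0]] by linarith
  qed
  {
    case base
    show ?case
    proof (cases "i = j")
      case True
      then show ?thesis
        using base residual_diag[OF dyadic_pt_in_dyadics[OF base(2)]] M r0[of m] w0[of m] by simp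
    next
      case False
      have "real j - real i \<le> 1"
      proof (rule mult_right_le_imp_le)
        show "(real j - real i) * (T / 2 ^ m) \<le> 1 * (T / 2 ^ m)"
          using base(3) by (simp add: dyadic_pt_def left_diff_distrib diff_divide_distrib)
      qed (use T_pos in simp)
      then have j: "j = Suc i" using base(1) False by linarith
      then have "\<tau> \<in> {0..T}" using base T_pos dyadic_pt_mono[OF T_pos, of i j m] by auto
      then have "N (S \<tau> (R (p m (Suc i)) (p m i))) \<le> M * r m"
        using base j by (intro action_elementary_residual r M) auto
      also have "\<dots> \<le> M * (2 * (r m + w m))"
        using r0[of m] w0[of m] M by (intro mult_left_mono) auto
      finally show ?thesis using j by simp
    qed
  next
    case (step n)
    have sum: "M * (\<Sum>l=m..Suc n. 2 * (r l + w l)) =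
        M * (\<Sum>l=m..n. 2 * (r l + w l)) + M * (2 * (r (Suc n) + w (Suc n)))"
      using step(1) by (simp add: distrib_left)
    show ?case
    proof (cases "i = j")
      case True
      have "0 \<le> (\<Sum>l=m..Suc n. 2 * (r l + w l))"
        using r0 w0 by (intro sum_nonneg) auto
      then have "0 \<le> M * (\<Sum>l=m..Suc n. 2 * (r l + w l))" using M by simp
      then show ?thesis
        using True step.prems residual_diag[OF dyadic_pt_in_dyadics[OF step.prems(2)]] by simp
    next
      case False
      \<comment> \<open>Round \<open>s\<close> up and \<open>t\<close> down to level \<open>n\<close>. As \<open>s \<noteq> t\<close>, the rounded points do not cross.\<close>
      define i' j' where "i' = Suc i div 2" and "j' = j div 2"
      define s s' t' t where "s = p (Suc n) i" and "s' = p n i'" and "t' = p n j'" and "t = p (Suc n) j"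
      have le: "i' \<le> j'" "j' \<le> 2 ^ n"
        using False step.prems(1,2) unfolding i'_def j'_def by (presburger, simp)
      have dy: "s \<in> dyadics T" "s' \<in> dyadics T" "t' \<in> dyadics T" "t \<in> dyadics T"
        using step.prems le unfolding s_def s'_def t'_def t_def by (auto intro!: dyadic_pt_in_dyadics)
      have s': "s' = p (Suc n) (2 * i')" and t': "t' = p (Suc n) (2 * j')"
        by (simp_all add: s'_def t'_def dyadic_pt_Suc_double)
      have lower: "2 * i' = i \<or> 2 * i' = Suc i" and upper: "j = 2 * j' \<or> j = Suc (2 * j')"
        unfolding i'_def j'_def by presburger+
      have ord: "s \<le> s'" "s' \<le> t'" "t' \<le> t"
        unfolding s' t' s_def t_def using le lower upper by (auto intro!: dyadic_pt_mono T_pos)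
      have gaps: "s' - s \<le> T / 2 ^ Suc n" "t - t' \<le> T / 2 ^ Suc n"
        unfolding s' t' s_def t_def using lower upper T_pos by (auto simp: dyadic_pt_Suc)
      have bd: "0 \<le> s" "t \<le> T" using dy dyadics_subset[OF T_pos] by auto
      have \<tau>: "0 \<le> \<tau>" "\<tau> + (t - s) \<le> T" using step.prems by (auto simp: s_def t_def)
      have bnd: "\<tau> \<in> {0..T}" "\<tau> + (t - t') \<in> {0..T}" "\<tau> + (t - s') \<in> {0..T}"
        using \<tau> ord by auto
      have "N (S (\<tau> + (t - t')) (R t' s')) \<le> M * (\<Sum>l=m..n. 2 * (r l + w l))"
        unfolding t'_def s'_def using le \<tau> ord step.prems(3)
        by (intro step.IH) (auto simp: s_def t_def s'_def t'_def)
      moreover have "N (S \<tau> (R t t')) \<le> M * r (Suc n)"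
      proof (cases "j = 2 * j'")
        case True
        then show ?thesis
          using residual_diag[OF dy(4)] r0[of "Suc n"] M \<tau> t' by (simp add: t_def)
      next
        case False
        then have "j = Suc (2 * j')" using upper by simp
        moreover have "2 * j' < 2 ^ Suc n" using step.prems(2) calculation by simp
        ultimately show ?thesis
          unfolding t_def t' using bnd by (simp only:) (intro action_elementary_residual r M)
      qed
      moreover have "N (S (\<tau> + (t - s')) (R s' s)) \<le> M * r (Suc n)"
      proof (cases "2 * i' = i")
        case True
        then show ?thesis
          using residual_diag[OF dy(1)] r0[of "Suc n"] M bnd s' by (simp add: s_def)
      next
        case False
        then have i: "2 * i' = Suc i" using lower by simp
        moreover have "i < 2 ^ Suc n" using step.prems(1,2) \<open>i \<noteq> j\<close> by simp
        ultimately show ?thesis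
          unfolding s' s_def i using bnd(3)[unfolded s' i] by (intro action_elementary_residual r M)
      qed
      moreover have "N (S (\<tau> + (t - t')) (H t' s' s)) \<le> M * w (Suc n)"
      proof -
        have "N (H t' s' s) \<le> w (Suc n)"
          using ord bd gaps by (intro w) (auto simp: simplex3_def)
        then show ?thesis
          using M(2)[OF bnd(2) H_mem] mult_left_mono[OF _ M(1)] order_trans by blast
      qed
      moreover have "N (S \<tau> (H t t' s)) \<le> M * w (Suc n)"
      proof -
        have "N (H t t' s) \<le> w (Suc n)"
          using ord bd gaps by (intro w) (auto simp: simplex3_def)
        then show ?thesis
          using M(2)[OF bnd(1) H_mem] mult_left_mono[OF _ M(1)] order_trans by blast
      qed
      moreover have "N (S \<tau> (R t s)) \<le> N (S (\<tau> + (t - t')) (R t' s')) + N (S \<tau> (R t t'))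
          + N (S (\<tau> + (t - s')) (R s' s)) + N (S (\<tau> + (t - t')) (H t' s' s)) + N (S \<tau> (H t t' s))"
        (is "_ \<le> N ?a + N ?b + N ?c + N ?d + N ?e")
      proof -
        have mem: "?a \<in> V" "?b \<in> V" "?c \<in> V" "?d \<in> V" "?e \<in> V"
          using bnd dy ord by (auto intro!: S_mem residual_mem)
        have eq: "S \<tau> (R t s) = ?a + ?b + ?c + ?d + ?e"
          using dy ord \<tau>(1) by (rule action_residual_refine)
        have "N (?a + ?b + ?c + ?d + ?e) \<le> N (?a + ?b + ?c + ?d) + N ?e"
          "N (?a + ?b + ?c + ?d) \<le> N (?a + ?b + ?c) + N ?d"
          "N (?a + ?b + ?c) \<le> N (?a + ?b) + N ?c" "N (?a + ?b) \<le> N ?a + N ?b"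
          using mem by (intro norm_add_le; simp)+
        then show ?thesis unfolding eq by linarith
      qed
      ultimately show ?thesis
        unfolding sum s_def[symmetric] t_def[symmetric] by (simp add: distrib_left)
    qed
  }
qed

lemma residual_small:
  assumes "e > 0"
  shows "\<exists>d>0. \<forall>s\<in>dyadics T. \<forall>t\<in>dyadics T. s \<le> t \<and> t - s < d \<longrightarrow> N (R t s) < e"
proof -
  obtain r where r: "summable r" "\<And>n k. k < 2 ^ n \<Longrightarrow> N (R (p n (Suc k)) (p n k)) \<le> r n"
    using level_residuals_summable by blast
  obtain K \<rho> where K: "K \<ge> 0" and \<rho>: "\<rho> > 0"
    and decay: "\<And>t u s. (t, u, s) \<in> simplex3 T \<Longrightarrow> N (H t u s) \<le> K * min (t - u) (u - s) powr \<rho>"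
    using cocycle_decay[OF H_cocycle \<gamma>_pos T_pos] by blast
  define w where "w n = K * (T / 2 ^ n) powr \<rho>" for n
  have w: "N (H t u s) \<le> w n"
    if "(t, u, s) \<in> simplex3 T" "min (t - u) (u - s) \<le> T / 2 ^ n" for n t u s
  proof -
    have "min (t - u) (u - s) powr \<rho> \<le> (T / 2 ^ n) powr \<rho>"
      using that \<rho> by (intro powr_mono2) (auto simp: simplex3_def)
    then show ?thesis
      using decay[OF that(1)] mult_left_mono[OF _ K] unfolding w_def by (blast intro: order_trans)
  qed
  obtain M where M: "M \<ge> 0" "\<And>t x. t \<in> {0..T} \<Longrightarrow> x \<in> V \<Longrightarrow> N (S t x) \<le> M * N x"
    using locally_bounded by blast
  have "summable w" unfolding w_def by (intro summable_mult summable_mesh_powr T_pos \<rho>)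
  then have "summable (\<lambda>l. 2 * (r l + w l))"
    using r(1) by (intro summable_mult summable_add)
  moreover have "e / (M + 1) > 0" using \<open>e > 0\<close> M by simp
  ultimately obtain m where m: "\<And>n. norm (\<Sum>l=m..<n. 2 * (r l + w l)) < e / (M + 1)"
    unfolding summable_Cauchy by blast
  have "N (R t s) < e" if st: "s \<in> dyadics T" "t \<in> dyadics T" "s \<le> t" "t - s < T / 2 ^ m" for s t
  proof -
    obtain n i j where n: "n \<ge> m" "j \<le> 2 ^ n" "s = p n i" "t = p n j"
      using dyadics_common_level[OF st(1,2), of m] by blast
    have "real i \<le> real j"
      using st(3) n T_pos by (simp add: dyadic_pt_def divide_le_cancel)
    then have "i \<le> j" by simp
    have "{s..t} \<subseteq> {0..T}" using dyadics_subset[OF T_pos] st by auto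
    then have "t - s \<le> T" using st(3) by auto
    then have "N (S 0 (R t s)) \<le> M * (\<Sum>l=m..n. 2 * (r l + w l))"
      using residual_chain[OF r(2) w M n(1) \<open>i \<le> j\<close> n(2), where \<tau> = 0] st n by simp
    also have "\<dots> \<le> M * (e / (M + 1))"
      using m[of "Suc n"] M by (intro mult_left_mono) (auto simp: atLeastLessThanSuc_atLeastAtMost)
    also have "\<dots> < e" using \<open>e > 0\<close> M by (auto simp: field_simps)
    finally show ?thesis using S_id[OF residual_mem[OF st(2,1,3)]] by simp
  qed
  then show ?thesis using T_pos by (intro exI[of _ "T / 2 ^ m"]) auto
qed

section \<open>Extending the path and the residual to all times\<close>

lemma path_eq_residual: "t \<in> dyadics T \<Longrightarrow> I t = - R t 0"
proof -
  assume t: "t \<in> dyadics T"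
  then have "0 \<le> t" "t \<le> T" using dyadics_subset[OF T_pos] by auto
  then show "I t = - R t 0"
    using cocycle_degenerate(2)[OF H_cocycle \<gamma>_pos T_pos, of 0 t] dyadic_path_rec(1)[OF T_pos, of S sp H]
    by (simp add: residual_def base_incr_def)
qed

text \<open>The admissibility condition on \<open>(S h - Id) R\<close> enters here: it controls the increment
  \<open>S (t - s) (I s) - I s\<close> of the path uniformly in \<open>s\<close>, since \<open>I s\<close> is, up to
  sign, the residual \<open>R s 0\<close>.\<close>

lemma path_increment_small:
  assumes "e > 0"
  shows "\<exists>d>0. \<forall>s\<in>dyadics T. \<forall>t\<in>dyadics T. s \<le> t \<and> t - s < d \<longrightarrow> N (I t - I s) < e"
proof -
  have e: "e / 3 > 0" using assms by simp
  obtain d1 where d1: "d1 > 0"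
    "\<And>s t. s \<in> dyadics T \<Longrightarrow> t \<in> dyadics T \<Longrightarrow> s \<le> t \<Longrightarrow> t - s < d1 \<Longrightarrow> N (R t s) < e / 3"
    using residual_small[OF e] by blast
  obtain K \<rho> where K: "K \<ge> 0" and \<rho>: "\<rho> > 0"
    and decay: "\<And>t u s. (t, u, s) \<in> simplex3 T \<Longrightarrow> N (H t u s) \<le> K * min (t - u) (u - s) powr \<rho>"
    using cocycle_decay[OF H_cocycle \<gamma>_pos T_pos] by blast
  define d2 where "d2 = (e / (3 * (K + 1))) powr (1 / \<rho>)"
  have "d2 > 0" using K assms by (simp add: d2_def)
  have d2: "N (H t s 0) < e / 3" if "0 \<le> s" "s \<le> t" "t \<le> T" "t - s < d2" for s t
  proof -
    have "min (t - s) (s - 0) powr \<rho> \<le> d2 powr \<rho>"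
      using that \<rho> by (intro powr_mono2) auto
    also have "\<dots> = e / (3 * (K + 1))" using \<rho> K assms by (simp add: d2_def powr_powr)
    finally have "K * min (t - s) (s - 0) powr \<rho> \<le> K * (e / (3 * (K + 1)))"
      using K by (intro mult_left_mono)
    also have "\<dots> < e / 3" using K assms by (auto simp: field_simps)
    finally show ?thesis
      using decay[of t s 0] that by (simp add: simplex3_def)
  qed
  have "((\<lambda>h. SUP (t, s) \<in> {(t, s). s \<le> t \<and> s \<in> dyadics T \<and> t \<in> dyadics T \<and> t + h \<le> T}.
                 ennreal (N (S h (R t s) - R t s))) \<longlongrightarrow> 0) (at_right 0)"
    using admissible H_in_D unfolding admissible_domain_def by blast
  then have "eventually (\<lambda>h. (SUP (t, s) \<in> {(t, s). s \<le> t \<and> s \<in> dyadics T \<and> t \<in> dyadics T \<and> t + h \<le> T}.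
                 ennreal (N (S h (R t s) - R t s))) < ennreal (e / 3)) (at_right 0)"
    using e by (intro order_tendstoD) auto
  then obtain d3 where d3: "d3 > 0" and sup: "\<And>h. 0 < h \<Longrightarrow> h < d3 \<Longrightarrow>
      (SUP (t, s) \<in> {(t, s). s \<le> t \<and> s \<in> dyadics T \<and> t \<in> dyadics T \<and> t + h \<le> T}.
                 ennreal (N (S h (R t s) - R t s))) < ennreal (e / 3)"
    unfolding eventually_at_right_field by blast
  have d3': "N (S h (R t s) - R t s) < e / 3"
    if "0 < h" "h < d3" "s \<le> t" "s \<in> dyadics T" "t \<in> dyadics T" "t + h \<le> T" for h t s
  proof -
    have "(t, s) \<in> {(t, s). s \<le> t \<and> s \<in> dyadics T \<and> t \<in> dyadics T \<and> t + h \<le> T}"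
      using that by simp
    from SUP_upper[OF this, of "\<lambda>(t, s). ennreal (N (S h (R t s) - R t s))"]
    have "ennreal (N (S h (R t s) - R t s)) < ennreal (e / 3)"
      using sup[OF that(1,2)] by (simp add: le_less_trans)
    moreover have "0 \<le> N (S h (R t s) - R t s)"
      using that by (intro norm_nonneg diff_mem S_mem residual_mem) auto
    ultimately show ?thesis by (simp only: ennreal_less_iff)
  qed
  have "N (I t - I s) < e"
    if st: "s \<in> dyadics T" "t \<in> dyadics T" "s \<le> t" "t - s < min d1 (min d2 d3)" for s t
  proof (cases "s = t")
    case True
    then show ?thesis using assms by simp
  next
    case False
    have bd: "0 \<le> s" "t \<le> T" using st dyadics_subset[OF T_pos] by auto
    have mem: "R s 0 \<in> V" "R t s \<in> V"
      using st bd zero_in_dyadics by (auto intro: residual_mem)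
    have "I t - I s = - H t s 0 - R t s - (S (t - s) (R s 0) - R s 0)"
    proof -
      have "I t = - H t s 0 - R t s + S (t - s) (I s)"
        by (simp add: residual_def base_incr_def)
      then show ?thesis
        using st mem by (simp add: path_eq_residual[OF st(1)] S_uminus)
    qed
    then have "N (I t - I s) \<le> N (- H t s 0 - R t s) + N (S (t - s) (R s 0) - R s 0)"
      using st mem by (simp add: norm_diff_le)
    moreover have "N (- H t s 0 - R t s) \<le> N (H t s 0) + N (R t s)"
      using norm_diff_le[of "- H t s 0" "R t s"] mem by (simp add: norm_uminus)
    moreover have "N (S (t - s) (R s 0) - R s 0) < e / 3"
      using st bd False zero_in_dyadics by (intro d3') auto
    moreover have "N (H t s 0) < e / 3" using st bd by (intro d2) auto
    moreover have "N (R t s) < e / 3" using st by (intro d1) auto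
    ultimately show ?thesis by linarith
  qed
  then show ?thesis
    using d1 \<open>d2 > 0\<close> d3 by (intro exI[of _ "min d1 (min d2 d3)"]) auto
qed

lemma path_extension:
  "\<exists>J. continuous_map (top_of_set {0..T}) (ntopology V N) J \<and> (\<forall>t\<in>dyadics T. J t = I t)"
proof -
  let ?m = "metric (V, ndist V N)"
  have "uniformly_continuous_map (submetric euclidean_metric (dyadics T)) ?m I"
    unfolding uniformly_continuous_map_def
  proof (intro conjI allI impI)
    show "I \<in> mspace (submetric euclidean_metric (dyadics T)) \<rightarrow> mspace ?m"
      by (simp add: path_mem)
    fix e :: real assume "e > 0"
    obtain d where d: "d > 0"
      "\<And>s t. s \<in> dyadics T \<Longrightarrow> t \<in> dyadics T \<Longrightarrow> s \<le> t \<Longrightarrow> t - s < d \<Longrightarrow> N (I t - I s) < e"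
      using path_increment_small[OF \<open>e > 0\<close>] by blast
    have "ndist V N (I t) (I s) < e" if st: "s \<in> dyadics T" "t \<in> dyadics T" "dist t s < d" for s t
    proof (cases "s \<le> t")
      case True
      then show ?thesis using d(2)[of s t] st by (simp add: ndist_def path_mem dist_real_def)
    next
      case False
      then show ?thesis
        using d(2)[of t s] st by (simp add: ndist_def path_mem dist_real_def norm_diff_commute)
    qed
    then show "\<exists>d>0. \<forall>x\<in>mspace (submetric euclidean_metric (dyadics T)).
        \<forall>y\<in>mspace (submetric euclidean_metric (dyadics T)).
          mdist (submetric euclidean_metric (dyadics T)) y x < d \<longrightarrow> mdist ?m (I y) (I x) < e"
      using d(1) by auto
  qed
  moreover have "mcomplete_of ?m" using complete by simp
  moreover have "{0..T} \<subseteq> mtopology_of euclidean_metric closure_of dyadics T"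
  proof
    fix t assume t: "t \<in> {0..T}"
    have "\<exists>s\<in>dyadics T. dist s t < e" if e: "e > 0" for e
    proof -
      obtain n where "T / 2 ^ n < e"
        using order_tendstoD(2)[OF mesh_tendsto_0 e] by (auto simp: eventually_sequentially)
      then show ?thesis
        using dyadic_floor[OF T_pos, of t n] t
        by (intro bexI[of _ "dyadic_floor T n t"]) (auto simp: dist_real_def)
    qed
    then show "t \<in> mtopology_of euclidean_metric closure_of dyadics T"
      by (simp add: closure_approachable)
  qed
  ultimately obtain J where J: "uniformly_continuous_map (submetric euclidean_metric {0..T}) ?m J"
    "\<And>t. t \<in> dyadics T \<Longrightarrow> J t = I t"
    using uniformly_continuous_map_extends_to_intermediate_closure_of by blast
  have "continuous_map (top_of_set {0..T}) (ntopology V N) J"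
    using uniformly_continuous_imp_continuous_map[OF J(1)]
    by (simp add: mtopology_of_submetric ntopology_def)
  then show ?thesis using J(2) by blast
qed

text \<open>Ordered pairs of dyadic times are dense in the simplex.\<close>

lemma cincr2_eqI:
  assumes g: "g \<in> cincr2 T V N" and h: "h \<in> cincr2 T V N"
    and eq: "\<And>s t. s \<in> dyadics T \<Longrightarrow> t \<in> dyadics T \<Longrightarrow> s \<le> t \<Longrightarrow> g t s = h t s"
  shows "g = h"
proof (intro ext)
  fix t s
  show "g t s = h t s"
  proof (cases "(t, s) \<in> simplex2 T")
    case False
    then show ?thesis using g h by (simp add: cincr2_def)
  next
    case True
    then have st: "0 \<le> s" "s \<le> t" "t \<le> T" by (auto simp: simplex2_def)
    have cont: "continuous_map (top_of_set (simplex2 T)) (ntopology V N)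
        (\<lambda>x. (\<lambda>(t, s). g t s) x - (\<lambda>(t, s). h t s) x)"
      using g h by (intro continuous_map_diff) (auto simp: cincr2_def)
    have mem: "g t s - h t s \<in> V" by (intro diff_mem cincr2_mem[OF g] cincr2_mem[OF h])
    have "N (g t s - h t s) < e" if e: "e > 0" for e
    proof -
      obtain d where "d > 0" and d': "\<forall>y\<in>simplex2 T. dist y (t, s) < d \<longrightarrow>
          N (((\<lambda>(t, s). g t s) y - (\<lambda>(t, s). h t s) y)
            - ((\<lambda>(t, s). g t s) (t, s) - (\<lambda>(t, s). h t s) (t, s))) < e"
        using cont[unfolded continuous_map_iff, THEN conjunct2, rule_format, OF True e] by blast
      have d: "N ((g t' s' - h t' s') - (g t s - h t s)) < e"
        if "(t', s') \<in> simplex2 T" "dist (t', s') (t, s) < d" for t' s'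
        using d'[rule_format, OF that] by simp
      obtain n where n: "T / 2 ^ n < d / 2"
        using order_tendstoD(2)[OF mesh_tendsto_0, of "d / 2" T] \<open>d > 0\<close>
        by (auto simp: eventually_sequentially)
      define t' s' where "t' = dyadic_floor T n t" and "s' = dyadic_floor T n s"
      have dy: "t' \<in> dyadics T" "s' \<in> dyadics T" "s' \<le> t'"
        using dyadic_floor(1)[OF T_pos] dyadic_floor_mono[OF T_pos] st by (auto simp: t'_def s'_def)
      then have mem2: "(t', s') \<in> simplex2 T"
        using dyadics_subset[OF T_pos] by (auto simp: simplex2_def)
      have "dist (t', s') (t, s) \<le> \<bar>t' - t\<bar> + \<bar>s' - s\<bar>"
        unfolding dist_Pair_Pair dist_real_def using sqrt_sum_squares_le_sum_abs by simp
      also have "\<dots> < d"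
      proof -
        have "\<bar>t' - t\<bar> \<le> T / 2 ^ n" "\<bar>s' - s\<bar> \<le> T / 2 ^ n"
          using st unfolding t'_def s'_def by (intro dyadic_floor T_pos; simp)+
        then show ?thesis using n by linarith
      qed
      finally have "N ((g t' s' - h t' s') - (g t s - h t s)) < e"
        by (rule d[OF mem2])
      then show ?thesis
        using eq[OF dy(2,1,3)] norm_uminus[OF mem] by simp
    qed
    then have "N (g t s - h t s) \<le> 0" by (meson linorder_not_le order_less_irrefl)
    then have "N (g t s - h t s) = 0" using norm_nonneg[OF mem] by linarith
    then show ?thesis using norm_eq_0_iff[OF mem] by simp
  qed
qed

text \<open>With \<open>J\<close> the extended path, the right-hand side is continuous and agrees with the dyadic
  residual at dyadic times, so by density it is the increment that the definite description
  selects.\<close>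

lemma sewing_map_representation:
  "\<exists>J. continuous_map (top_of_set {0..T}) (ntopology V N) J \<and> J 0 = 0 \<and>
     sewing_map T V N S sp H \<in> cincr2 T V N \<and>
     (\<forall>t s. (t, s) \<in> simplex2 T \<longrightarrow>
        sewing_map T V N S sp H t s = base_incr H t s - J t + S (t - s) (J s))"
proof -
  obtain J where J: "continuous_map (top_of_set {0..T}) (ntopology V N) J"
    and JI: "\<And>t. t \<in> dyadics T \<Longrightarrow> J t = I t"
    using path_extension by blast
  define L where "L t s = (if (t, s) \<in> simplex2 T then base_incr H t s - J t + S (t - s) (J s) else 0)"
    for t s
  have L_cincr: "L \<in> cincr2 T V N"
    unfolding cincr2_def
  proof (intro CollectI conjI allI impI)
    let ?X = "top_of_set (simplex2 T)"
    have "continuous_map ?X (top_of_set (simplex3 T)) (\<lambda>(t, s). (t, s, 0))"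
      unfolding continuous_map_subtopology_eu case_prod_unfold
      by (intro conjI continuous_intros) (auto simp: simplex2_def simplex3_def)
    moreover have "continuous_map (top_of_set (simplex3 T)) (ntopology V N) (\<lambda>(t, u, s). H t u s)"
      using H_cocycle by (simp add: cocycles_def cincr3_def)
    ultimately have "continuous_map ?X (ntopology V N) ((\<lambda>(t, u, s). H t u s) \<circ> (\<lambda>(t, s). (t, s, 0)))"
      by (rule continuous_map_compose)
    then have base: "continuous_map ?X (ntopology V N) (\<lambda>x. - H (fst x) (snd x) 0)"
      by (intro continuous_map_uminus) (simp add: o_def case_prod_unfold)
    have "continuous_map ?X (top_of_set {0..T}) fst" "continuous_map ?X (top_of_set {0..T}) snd"
      unfolding continuous_map_subtopology_eu
      by (intro conjI continuous_intros; auto simp: simplex2_def)+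
    from this[THEN continuous_map_compose, OF J]
    have path: "continuous_map ?X (ntopology V N) (\<lambda>x. J (fst x))"
      "continuous_map ?X (ntopology V N) (\<lambda>x. J (snd x))"
      by (simp_all only: o_def)
    have "continuous_map ?X (ntopology V N) (\<lambda>x. S (fst x - snd x) (J (snd x)))"
    proof (rule continuous_map_action[OF path(2)])
      show "continuous_on (simplex2 T) (\<lambda>x. fst x - snd x)" by (intro continuous_intros)
      show "fst x - snd x \<in> {0..T}" if "x \<in> simplex2 T" for x
        using that by (auto simp: simplex2_def)
    qed
    with continuous_map_diff[OF base path(1)]
    have "continuous_map ?X (ntopology V N)
        (\<lambda>x. - H (fst x) (snd x) 0 - J (fst x) + S (fst x - snd x) (J (snd x)))"
      by (rule continuous_map_add)
    then show "continuous_map ?X (ntopology V N) (\<lambda>(t, s). L t s)"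
      by (rule continuous_map_eq) (auto simp: L_def base_incr_def)
  qed (simp add: L_def)
  have L_residual: "L t s = R t s" if "s \<in> dyadics T" "t \<in> dyadics T" "s \<le> t" for s t
    using that dyadics_subset[OF T_pos] by (auto simp: L_def simplex2_def residual_def JI)
  have "sewing_map T V N S sp H = L"
    unfolding sewing_map_def
  proof (rule the_equality)
    fix L' assume "L' \<in> cincr2 T V N \<and>
      (\<forall>t\<in>dyadics T. \<forall>s\<in>dyadics T. s \<le> t \<longrightarrow> L' t s = R t s)"
    then show "L' = L" using L_cincr L_residual by (intro cincr2_eqI) auto
  qed (use L_cincr L_residual in auto)
  moreover have "J 0 = 0"
    using JI[OF zero_in_dyadics] dyadic_path_rec(1)[OF T_pos, of S sp H] by simp
  ultimately show ?thesis
    using J L_cincr by (intro exI[of _ J]) (simp add: L_def)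
qed

end

section \<open>Integration of increments\<close>

theorem theorem7p9:
  fixes T \<gamma> \<alpha> :: real
    and B :: "real \<Rightarrow> 'a::real_vector set"
    and nrm :: "real \<Rightarrow> 'a \<Rightarrow> real"
    and S :: "real \<Rightarrow> 'a \<Rightarrow> 'a"
    and sp :: "'a splitting_rule"
    and D :: "(real \<Rightarrow> real \<Rightarrow> real \<Rightarrow> 'a) set"
    and A :: "real \<Rightarrow> real \<Rightarrow> 'a"
  assumes "T > 0"
    and "banach_scale B nrm"
    and "analytic_semigroup_on_scale T B nrm S"
    and "0 < \<gamma>" and "\<gamma> \<le> 1"
    and "admissible_domain T (B \<alpha>) (nrm \<alpha>) S \<gamma> sp D"
    and "A \<in> cincr2 T (B \<alpha>) (nrm \<alpha>)"
    and "delta2 T S A \<in> cocycles T (B \<alpha>) (nrm \<alpha>) S \<gamma>"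
    and "delta2 T S A \<in> D"
  shows
    "delta1 T S (sewn_path T (B \<alpha>) (nrm \<alpha>) S sp A) = sewn_incr T (B \<alpha>) (nrm \<alpha>) S sp A \<and>
     (\<forall>(t, s) \<in> simplex2 T.
        delta1 T S (sewn_path T (B \<alpha>) (nrm \<alpha>) S sp A) t s =
          A t s - sewing_map T (B \<alpha>) (nrm \<alpha>) S sp (delta2 T S A) t s) \<and>
     sewn_path T (B \<alpha>) (nrm \<alpha>) S sp A \<in> cpaths T (B \<alpha>) (nrm \<alpha>) \<and>
     sewn_path T (B \<alpha>) (nrm \<alpha>) S sp A 0 = 0 \<and>
     (\<forall>I. (\<forall>t\<in>{0..T}. I t \<in> B \<alpha>) \<and>
          delta1 T S I = sewn_incr T (B \<alpha>) (nrm \<alpha>) S sp A \<and> I 0 = 0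
        \<longrightarrow> (\<forall>t\<in>{0..T}. I t = sewn_path T (B \<alpha>) (nrm \<alpha>) S sp A t))"
proof -
  let ?V = "B \<alpha>" and ?N = "nrm \<alpha>" and ?H = "delta2 T S A"
  interpret dyadic_recursion ?V ?N S T \<gamma> sp D ?H
  proof unfold_locales
    show "banach_on ?V ?N" using assms(2) by (simp add: banach_scale_def)
    show "c0_semigroup_on ?V ?N S"
      using assms(3) by (simp add: analytic_semigroup_on_scale_def analytic_semigroup_on_def)
  qed fact+
  let ?L = "sewing_map T ?V ?N S sp ?H" and ?J = "sewn_incr T ?V ?N S sp A"
    and ?I = "sewn_path T ?V ?N S sp A"
  obtain J where J: "continuous_map (top_of_set {0..T}) (ntopology ?V ?N) J" "J 0 = 0"
    and L: "?L \<in> cincr2 T ?V ?N"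
      "\<And>t s. (t, s) \<in> simplex2 T \<Longrightarrow> ?L t s = base_incr ?H t s - J t + S (t - s) (J s)"
    using sewing_map_representation by blast
  note A_mem = cincr2_mem[OF assms(7)]
  have J_mem: "J t \<in> ?V" if "t \<in> {0..T}" for t
    using J(1) that unfolding continuous_map_iff by auto
  have vanish: "A t s = 0" "?L t s = 0" if "(t, s) \<notin> simplex2 T" for t s
    using assms(7) L(1) that by (auto simp: cincr2_def)
  have A00: "A 0 0 = 0"
  proof -
    have "?H 0 0 0 = 0"
      using assms(1) by (intro cocycle_degenerate[OF assms(8,4,1)]) auto
    then show ?thesis
      using assms(1) S_id[OF A_mem] by (simp add: delta2_eq simplex3_def)
  qed
  have path: "?I t = A t 0 + J t" if t: "t \<in> {0..T}" for t
  proof -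
    have "?H t 0 0 = 0"
      using t by (intro cocycle_degenerate[OF assms(8,4,1)]) auto
    then have "?L t 0 = - J t"
      using t J(2) L(2)[of t 0] by (simp add: simplex2_def base_incr_def)
    then show ?thesis by (simp add: sewn_path_def sewn_incr_def)
  qed
  have path_0: "?I 0 = 0"
    using path[of 0] assms(1) A00 J(2) by simp
  have incr: "?J t s = ?I t - S (t - s) (?I s)" if ts: "(t, s) \<in> simplex2 T" for t s
  proof -
    have st: "s \<in> {0..T}" "t \<in> {0..T}" "s \<le> t" using ts by (auto simp: simplex2_def)
    have "base_incr ?H t s = - A t 0 + A t s + S (t - s) (A s 0)"
      using st by (simp add: base_incr_def delta2_eq simplex3_def)
    then show ?thesis
      using st A_mem J_mem by (simp add: sewn_incr_def L(2)[OF ts] path S_add)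
  qed
  have delta: "delta1 T S ?I = ?J"
  proof (intro ext)
    fix t s show "delta1 T S ?I t s = ?J t s"
      using incr[of t s] vanish[of t s] by (cases "(t, s) \<in> simplex2 T") (simp_all add: delta1_eq sewn_incr_def)
  qed
  have "?I \<in> cpaths T ?V ?N"
    unfolding cpaths_def
  proof (intro CollectI conjI allI impI)
    have "continuous_map (top_of_set {0..T}) (top_of_set (simplex2 T)) (\<lambda>t. (t, 0))"
      unfolding continuous_map_subtopology_eu
      by (intro conjI continuous_intros) (auto simp: simplex2_def)
    moreover have "continuous_map (top_of_set (simplex2 T)) (ntopology ?V ?N) (\<lambda>(t, s). A t s)"
      using assms(7) by (simp add: cincr2_def)
    ultimately have "continuous_map (top_of_set {0..T}) (ntopology ?V ?N) ((\<lambda>(t, s). A t s) \<circ> (\<lambda>t. (t, 0)))"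
      by (rule continuous_map_compose)
    then have "continuous_map (top_of_set {0..T}) (ntopology ?V ?N) (\<lambda>t. A t 0 + J t)"
      by (intro continuous_map_add J) (simp add: o_def)
    then show "continuous_map (top_of_set {0..T}) (ntopology ?V ?N) ?I"
      by (rule continuous_map_eq) (simp add: path)
    show "?I t = 0" if "t \<notin> {0..T}" for t
      using that vanish[of t 0] by (auto simp: sewn_path_def sewn_incr_def simplex2_def)
  qed
  moreover have "\<forall>I. (\<forall>t\<in>{0..T}. I t \<in> ?V) \<and> delta1 T S I = ?J \<and> I 0 = 0
      \<longrightarrow> (\<forall>t\<in>{0..T}. I t = ?I t)"
  proof (intro allI impI ballI)
    fix I' t
    assume I': "(\<forall>t\<in>{0..T}. I' t \<in> ?V) \<and> delta1 T S I' = ?J \<and> I' 0 = 0" and t: "t \<in> {0..T}"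
    then have "?J t 0 = delta1 T S I' t 0" by simp
    also have "\<dots> = I' t - S t (I' 0)" using t by (simp add: delta1_eq simplex2_def)
    also have "\<dots> = I' t" using I' t by simp
    finally show "I' t = ?I t" by (simp add: sewn_path_def)
  qed
  moreover have "\<forall>(t, s) \<in> simplex2 T. delta1 T S ?I t s = A t s - ?L t s"
    unfolding delta by (simp add: sewn_incr_def case_prod_unfold)
  ultimately show ?thesis
    using delta path_0 by blast
qed

end
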